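(* Say that a cyclic word $u$ in $F_2$ is admissible if (i) $u$ has the minimum length over all cyclic words in its automorphic orbit $\mathrm{Orb}_{\mathrm{Aut}F_2}(u)$, and (ii) if both $x_1^{\pm 1}$ and $x_2^{\pm 1}$ occur in $u$ (that is, at least one of $x_1,x_1^{-1}$ and at least one of $x_2,x_2^{-1}$ occurs in $u$), then the total number of occurrences of $x_1^{\pm 1}$ in $u$ is strictly less than the total number of occurrences of $x_2^{\pm 1}$ in $u$. Then $N(u)\le 8|u|-40$ for every admissible cyclic word $u$ in $F_2$ with $|u|\ge 9$. Moreover, there exists a sequence $(u_l)$ of admissible cyclic words in $F_2$ such that $|u_l|\ge 9$ for all $l$, $|u_l|\to\infty$ as $l\to\infty$, and $N(u_l)=8|u_l|-40$ for all $l$. Thus $N(u)$ has the sharp bound $8|u|-40$ for admissible $u$ with $|u|\ge 9$.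
   Context: $F_2$ is the free group on $\{x_1,x_2\}$, and the set of letters is $\Sigma=\{x_1,x_2\}^{\pm 1}$. A cyclic word in $F_2$ is a cyclically ordered set of letters with no pair of inverses adjacent (equivalently, a cyclically reduced word up to cyclic permutation, i.e. a conjugacy class of $F_2$). The length $|w|$ of a cyclic word $w$ is the number of elements in the cyclically ordered set. Automorphisms of $F_2$ act on cyclic words (apply the automorphism and cyclically reduce), and $\mathrm{Orb}_{\mathrm{Aut}F_2}(w)=\{\psi(w):\psi\in \mathrm{Aut}F_2\}$. For a cyclic word $u$ of minimum length in its orbit, $N(u)$ denotes the cardinality of the set of cyclic words $\{v\in \mathrm{Orb}_{\mathrm{Aut}F_2}(u): |v|=|u|\}$. *)

theory Defs
  imports Complex_Main "HOL-Algebra.Bij"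
begin

text \<open>The letter \<open>(X\<^sub>i, True)\<close> stands for $x_i$ and \<open>(X\<^sub>i, False)\<close> for $x_i^{-1}$.\<close>

datatype gen = X1 | X2

type_synonym letter = "gen \<times> bool"
type_synonym word = "letter list"

definition inv_letter :: "letter \<Rightarrow> letter" where
  "inv_letter a = (fst a, \<not> snd a)"

definition reduced :: "word \<Rightarrow> bool" where
  "reduced w \<longleftrightarrow> successively (\<lambda>a b. b \<noteq> inv_letter a) w"

definition cyclically_reduced :: "word \<Rightarrow> bool" where
  "cyclically_reduced w \<longleftrightarrow> reduced w \<and> (w \<noteq> [] \<longrightarrow> last w \<noteq> inv_letter (hd w))"

fun cons_reduce :: "letter \<Rightarrow> word \<Rightarrow> word" where
  "cons_reduce a [] = [a]"
| "cons_reduce a (b # w) = (if b = inv_letter a then w else a # b # w)"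

definition reduce :: "word \<Rightarrow> word" where
  "reduce w = foldr cons_reduce w []"

definition F2 :: "word monoid" where
  "F2 = \<lparr>carrier = {w. reduced w}, mult = (\<lambda>u v. reduce (u @ v)), one = []\<rparr>"

text \<open>Cyclic reduction, for reduced arguments.\<close>

fun cyclic_reduce :: "word \<Rightarrow> word" where
  "cyclic_reduce [] = []"
| "cyclic_reduce (a # w) =
     (if w \<noteq> [] \<and> last w = inv_letter a then cyclic_reduce (butlast w) else a # w)"

text \<open>A cyclic word is the set of all cyclic permutations of a cyclically reduced word. The
  empty word is included: \<open>{[]}\<close> is the conjugacy class of the identity.\<close>

type_synonym cyclic_word = "word set"

definition cyclic_class :: "word \<Rightarrow> cyclic_word" where
  "cyclic_class w = {rotate n w | n. True}"

definition cyclic_words :: "cyclic_word set" where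
  "cyclic_words = {cyclic_class w | w. cyclically_reduced w}"

text \<open>An arbitrary linear representative. Nothing below depends on the choice: rotations
  preserve length and letter counts, and conjugate elements have conjugate images under an
  automorphism.\<close>

definition representative :: "cyclic_word \<Rightarrow> word" where
  "representative u = (SOME w. w \<in> u)"

definition cyclic_length :: "cyclic_word \<Rightarrow> nat" where
  "cyclic_length u = length (representative u)"

definition occurrences :: "gen \<Rightarrow> cyclic_word \<Rightarrow> nat" where
  "occurrences g u = length (filter (\<lambda>a. fst a = g) (representative u))"

definition act :: "(word \<Rightarrow> word) \<Rightarrow> cyclic_word \<Rightarrow> cyclic_word" where
  "act \<psi> u = cyclic_class (cyclic_reduce (\<psi> (representative u)))"

definition Orb :: "cyclic_word \<Rightarrow> cyclic_word set" where
  "Orb u = {act \<psi> u | \<psi>. \<psi> \<in> auto F2}"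

definition minimal_in_orbit :: "cyclic_word \<Rightarrow> bool" where
  "minimal_in_orbit u \<longleftrightarrow> (\<forall>v \<in> Orb u. cyclic_length u \<le> cyclic_length v)"

definition N :: "cyclic_word \<Rightarrow> nat" where
  "N u = card {v \<in> Orb u. cyclic_length v = cyclic_length u}"

definition admissible :: "cyclic_word \<Rightarrow> bool" where
  "admissible u \<longleftrightarrow> u \<in> cyclic_words \<and> minimal_in_orbit u \<and>
     (occurrences X1 u > 0 \<and> occurrences X2 u > 0 \<longrightarrow> occurrences X1 u < occurrences X2 u)"


subsection \<open>\<open>F2\<close> is a group\<close>

lemma inv_letter_inv_letter [simp]: "inv_letter (inv_letter a) = a"
  by (simp add: inv_letter_def)

lemma reduced_Nil [simp]: "reduced []"
  by (simp add: reduced_def)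

lemma reduced_Cons: "reduced (a # w) \<longleftrightarrow> (w = [] \<or> hd w \<noteq> inv_letter a) \<and> reduced w"
  by (cases w) (auto simp: reduced_def)

lemma reduced_cons_reduce: "reduced w \<Longrightarrow> reduced (cons_reduce a w)"
  by (cases w) (auto simp: reduced_Cons)

lemma reduced_foldr: "reduced w \<Longrightarrow> reduced (foldr cons_reduce u w)"
  by (induction u) (auto intro: reduced_cons_reduce)

lemma reduced_reduce [simp]: "reduced (reduce w)"
  by (simp add: reduce_def reduced_foldr)

lemma reduce_reduced: "reduced w \<Longrightarrow> reduce w = w"
proof (induction w)
  case (Cons a w)
  then show ?case by (cases w) (auto simp: reduced_Cons reduce_def)
qed (simp add: reduce_def)

lemma cons_reduce_inv:
  assumes "reduced w"
  shows "cons_reduce a (cons_reduce (inv_letter a) w) = w"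
  using assms by (cases w; cases "tl w") (auto simp: reduced_Cons)

lemma foldr_cons_reduce:
  assumes "reduced w"
  shows "foldr cons_reduce (cons_reduce a u) w = cons_reduce a (foldr cons_reduce u w)"
proof (cases u)
  case (Cons b u')
  then show ?thesis
    using cons_reduce_inv[OF reduced_foldr[OF assms, of u'], of a] by auto
qed simp

lemma foldr_reduce:
  "reduced w \<Longrightarrow> foldr cons_reduce (reduce u) w = foldr cons_reduce u w"
  by (induction u) (auto simp: reduce_def foldr_cons_reduce)

lemma reduce_append: "reduce (u @ v) = foldr cons_reduce u (reduce v)"
  by (simp add: reduce_def)

lemma reduce_append_left: "reduce (reduce u @ v) = reduce (u @ v)"
  by (simp add: reduce_append foldr_reduce)

lemma reduce_append_right: "reduce (u @ reduce v) = reduce (u @ v)"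
  by (simp add: reduce_append reduce_reduced)

lemma reduce_inverse: "reduce (rev (map inv_letter w) @ w) = []"
proof (induction w)
  case (Cons a w)
  have "foldr cons_reduce (rev (map inv_letter w)) (reduce w) = []"
    using Cons.IH by (simp add: reduce_append)
  moreover have "cons_reduce (inv_letter a) (cons_reduce a (reduce w)) = reduce w"
    using cons_reduce_inv[of "reduce w" "inv_letter a"] by simp
  ultimately show ?case by (simp add: reduce_def)
qed (simp add: reduce_def)

lemma group_F2: "group F2"
proof (rule groupI)
  fix w assume "w \<in> carrier F2"
  have "reduce (reduce (rev (map inv_letter w)) @ w) = []"
    by (simp add: reduce_append_left reduce_inverse)
  then show "\<exists>v\<in>carrier F2. v \<otimes>\<^bsub>F2\<^esub> w = \<one>\<^bsub>F2\<^esub>"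
    by (intro bexI[of _ "reduce (rev (map inv_letter w))"]) (auto simp: F2_def)
qed (auto simp: F2_def reduce_append_left reduce_append_right reduce_reduced)

end

theory Submission
  imports Defs "HOL-Library.Multiset"
begin

text \<open>
  Up to conjugacy and signed permutations of the generators, the bases of \<open>F\<^sub>2\<close> are the edges of
  the Farey tessellation, and passing to an adjacent edge is a transvection
  \<open>x\<^sub>1 \<mapsto> x\<^sub>1x\<^sub>2\<^sup>\<plusminus>\<^sup>1\<close> or \<open>x\<^sub>2 \<mapsto> x\<^sub>2x\<^sub>1\<^sup>\<plusminus>\<^sup>1\<close>. Nielsen reduction shows that every automorphism acts on
  cyclic words as \<open>\<pi> P \<rho>\<close> with \<open>\<pi>, \<rho>\<close> signed permutations and \<open>P\<close> a product of the positive
  transvections, that is, a path without backtracking in the dual tree.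

  Write a cyclic word as a product of syllables \<open>x\<^sub>1\<^sup>\<plusminus>\<^sup>1x\<^sub>2\<^sup>m\<close>, with exponents \<open>m = m\<^sub>i\<close>.
  Under \<open>x\<^sub>1 \<mapsto> x\<^sub>1x\<^sub>2\<^sup>k\<close> it keeps its
  \<open>p\<close> letters \<open>x\<^sub>1\<^sup>\<plusminus>\<^sup>1\<close>, and the number of letters \<open>x\<^sub>2\<^sup>\<plusminus>\<^sup>1\<close> becomes \<open>\<Sum>\<^sub>i \<bar>m\<^sub>i + k e\<^sub>i\<bar>\<close> with
  \<open>e\<^sub>i \<in> {-1, 0, 1}\<close>. This is convex in \<open>k\<close>, so the length never drops along a path once it has failed to
  drop in the first step; and if \<open>p\<close> is smaller than the number \<open>q\<close> of letters \<open>x\<^sub>2\<^sup>\<plusminus>\<^sup>1\<close>, it stays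
  constant only along powers of \<open>x\<^sub>1 \<mapsto> x\<^sub>1x\<^sub>2\<close>. Hence \<open>N\<close> is at most \<open>8\<close> times the number of
  integers on which the convex function is minimal. If these are \<open>d + 1\<close> consecutive integers and
  \<open>\<mu> = \<Sum>\<^sub>i \<bar>e\<^sub>i\<bar>\<close>, then \<open>2q \<ge> d\<mu> + 2(p - \<mu>)\<close>, and \<open>\<mu>\<close> is even when \<open>d > 0\<close>. This gives \<open>d + 1 \<le> p + q - 5\<close>
  except for the words \<open>x\<^sub>1x\<^sub>2\<^sup>mx\<^sub>1x\<^sub>2\<^sup>n\<close> and their images under \<open>x\<^sub>1 \<mapsto> x\<^sub>1\<^sup>-\<^sup>1\<close>, where
  \<open>x\<^sub>2 \<mapsto> x\<^sub>2\<^sup>-\<^sup>1\<close> identifies the images in pairs. The bound is attained by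
  \<open>x\<^sub>1 x\<^sub>1x\<^sub>2\<^sup>-\<^sup>d x\<^sub>1x\<^sub>2 x\<^sub>1\<^sup>-\<^sup>1x\<^sub>2\<close> for \<open>d \<ge> 3\<close>.
\<close>

section \<open>Words and substitutions\<close>

definition winv :: "word \<Rightarrow> word" where
  "winv w = rev (map inv_letter w)"

lemma winv_simps [simp]:
  "winv [] = []" "winv (a # w) = winv w @ [inv_letter a]" "winv (u @ v) = winv v @ winv u"
  "winv (winv w) = w" "length (winv w) = length w" "winv w = [] \<longleftrightarrow> w = []"
  by (auto simp: winv_def rev_map o_def)

lemma inv_letter_neq [simp]: "inv_letter a \<noteq> a" "a \<noteq> inv_letter a"
  by (cases a; simp add: inv_letter_def)+

lemma inv_letter_eq_iff [simp]: "inv_letter a = inv_letter b \<longleftrightarrow> a = b"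
  by (metis inv_letter_inv_letter)

lemma inv_letter_swap: "a = inv_letter b \<longleftrightarrow> b = inv_letter a"
  by auto

lemma reduced_append:
  "reduced (u @ v) \<longleftrightarrow> reduced u \<and> reduced v \<and> (u = [] \<or> v = [] \<or> hd v \<noteq> inv_letter (last u))"
  by (auto simp: reduced_def successively_append_iff)

lemma reduced_winv [simp]: "reduced (winv w) = reduced w"
proof -
  have "reduced w \<Longrightarrow> reduced (winv w)" for w
    by (induction w) (auto simp: reduced_Cons reduced_append winv_def last_rev hd_map last_map)
  from this[of w] this[of "winv w"] show ?thesis by auto
qed

lemma reduce_cong:
  assumes "reduce u = reduce u'" "reduce v = reduce v'"
  shows "reduce (u @ v) = reduce (u' @ v')"
  by (metis assms reduce_append_left reduce_append_right)

lemma reduce_Nil [simp]: "reduce [] = []"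
  by (simp add: reduce_def)

lemma reduce_winv_left [simp]: "reduce (winv w @ w) = []"
  by (simp add: winv_def reduce_inverse)

lemma reduce_winv_right [simp]: "reduce (w @ winv w) = []"
  by (metis reduce_winv_left winv_simps(4))

lemma reduce_cancel [simp]:
  "reduce (winv w @ w @ u) = reduce u" "reduce (w @ winv w @ u) = reduce u"
  using reduce_cong[of "winv w @ w" "[]" u u] reduce_cong[of "w @ winv w" "[]" u u] by auto

lemma reduce_winv: "reduce (winv w) = winv (reduce w)"
proof -
  have "reduce (winv w) = reduce (winv (reduce w) @ reduce w @ winv w)"
    by (metis reduce_cancel(1))
  also have "\<dots> = reduce (winv (reduce w) @ (w @ winv w))"
    by (metis reduce_cong reduce_append_left)
  also have "\<dots> = reduce (winv (reduce w))"
    by (metis append_Nil2 reduce_Nil reduce_cong reduce_winv_right)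
  finally show ?thesis by (simp add: reduce_reduced)
qed

lemma reduce_idem [simp]: "reduce (reduce w) = reduce w"
  by (simp add: reduce_reduced)

lemma reduce_Cons: "reduce (a # w) = cons_reduce a (reduce w)"
  by (simp add: reduce_def)

definition hom_letter :: "word \<Rightarrow> word \<Rightarrow> letter \<Rightarrow> word" where
  "hom_letter U V a = (let w = (case fst a of X1 \<Rightarrow> U | X2 \<Rightarrow> V) in if snd a then w else winv w)"

text \<open>Images are concatenated without reduction, so that composition is an exact identity of
  words (\<open>subst_subst\<close>) and cancellation enters only through
  \<open>reduce\<close>.\<close>

definition subst :: "word \<Rightarrow> word \<Rightarrow> word \<Rightarrow> word" where
  "subst U V w = concat (map (hom_letter U V) w)"

lemma subst_simps [simp]:
  "subst U V [] = []" "subst U V (a # w) = hom_letter U V a @ subst U V w"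
  "subst U V (u @ v) = subst U V u @ subst U V v"
  by (auto simp: subst_def)

lemma hom_letter_simps [simp]:
  "hom_letter U V (X1, True) = U" "hom_letter U V (X1, False) = winv U"
  "hom_letter U V (X2, True) = V" "hom_letter U V (X2, False) = winv V"
  by (auto simp: hom_letter_def)

lemma inv_letter_pair [simp]: "inv_letter (g, s) = (g, \<not> s)"
  by (simp add: inv_letter_def)

lemma letter_cases [case_names x1 X1 x2 X2]:
  "\<lbrakk>a = (X1, True) \<Longrightarrow> P; a = (X1, False) \<Longrightarrow> P; a = (X2, True) \<Longrightarrow> P; a = (X2, False) \<Longrightarrow> P\<rbrakk> \<Longrightarrow> P"
  by (cases a; cases "fst a"; cases "snd a") auto

lemma hom_letter_inv: "hom_letter U V (inv_letter a) = winv (hom_letter U V a)"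
  by (cases a rule: letter_cases) auto

lemma subst_winv: "subst U V (winv w) = winv (subst U V w)"
  by (induction w) (auto simp: hom_letter_inv)

lemma subst_subst: "subst U V (subst U' V' w) = subst (subst U V U') (subst U V V') w"
proof (induction w)
  case (Cons a w)
  then show ?case by (cases a rule: letter_cases) (auto simp: subst_winv)
qed simp

lemma subst_id [simp]: "subst [(X1, True)] [(X2, True)] w = w"
proof (induction w)
  case (Cons a w)
  then show ?case by (cases a rule: letter_cases) auto
qed simp

lemma reduce_subst_reduce: "reduce (subst U V (reduce w)) = reduce (subst U V w)"
proof (induction w)
  case (Cons a w)
  let ?h = "hom_letter U V"
  have "reduce (subst U V (cons_reduce a (reduce w))) = reduce (?h a @ subst U V (reduce w))"
  proof (cases "reduce w")
    case (Cons b v)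
    have "reduce (?h a @ ?h (inv_letter a) @ subst U V v) = reduce (subst U V v)"
      by (simp add: hom_letter_inv)
    then show ?thesis using Cons by auto
  qed simp
  also have "\<dots> = reduce (?h a @ subst U V w)"
    using Cons.IH by (intro reduce_cong) auto
  finally show ?case by (simp add: reduce_Cons)
qed simp

lemma reduce_subst_cong:
  "reduce w = reduce w' \<Longrightarrow> reduce (subst U V w) = reduce (subst U V w')"
  by (metis reduce_subst_reduce)

lemma reduce_subst_cong_images:
  assumes "reduce U = reduce U'" "reduce V = reduce V'"
  shows "reduce (subst U V w) = reduce (subst U' V' w)"
proof (induction w)
  case (Cons a w)
  have "reduce (hom_letter U V a) = reduce (hom_letter U' V' a)"
    using assms by (cases a rule: letter_cases) (auto simp: reduce_winv)
  then show ?case using Cons.IH by (auto intro: reduce_cong)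
qed simp

section \<open>Conjugacy\<close>

text \<open>Total on words, reduced or not, so that conjugacy in the group becomes equality of
  \<open>cyc\<close> and unreduced products can be handled directly.\<close>

definition cyc :: "word \<Rightarrow> cyclic_word" where
  "cyc w = cyclic_class (cyclic_reduce (reduce w))"

lemma cyc_cong: "reduce w = reduce w' \<Longrightarrow> cyc w = cyc w'"
  by (simp add: cyc_def)

lemma cyclic_class_rotate: "cyclic_class (rotate n w) = cyclic_class w"
proof -
  have *: "cyclic_class (rotate n w) \<subseteq> cyclic_class w" for n w
    by (auto simp: cyclic_class_def rotate_rotate)
  obtain m where "rotate m (rotate n w) = w"
  proof (cases "w = []")
    case False
    have "rotate (length w - n mod length w) (rotate n w)
        = rotate ((length w - n mod length w) + n mod length w) w"
      by (metis rotate_conv_mod rotate_rotate)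
    also have "\<dots> = w" using False by (simp add: less_imp_le)
    finally show ?thesis using that by blast
  qed (simp add: that)
  with *[of m "rotate n w"] *[of n w] show ?thesis by auto
qed

lemma cyclic_class_append: "cyclic_class (u @ v) = cyclic_class (v @ u)"
  by (metis cyclic_class_rotate rotate_append)

lemma cyclic_reduce_id:
  "w = [] \<or> last w \<noteq> inv_letter (hd w) \<Longrightarrow> cyclic_reduce w = w"
  by (cases w) auto

lemma reduce_snoc:
  assumes "reduced w" "w \<noteq> []" "last w = inv_letter a"
  shows "reduce (w @ [a]) = butlast w"
proof -
  have "w @ [a] = butlast w @ winv [a] @ [a]" using assms by (metis append_assoc append_butlast_last_id winv_simps(1,2) append_Nil)
  then have "reduce (w @ [a]) = reduce (butlast w)"
    by (metis append_Nil2 reduce_Nil reduce_append_right reduce_winv_left)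
  moreover have "reduced (butlast w)"
    using assms by (metis append_butlast_last_id reduced_append)
  ultimately show ?thesis by (simp add: reduce_reduced)
qed

text \<open>Conjugation by one letter, from which conjugation invariance follows. With
  \<open>g\<close> the reduced form of \<open>w\<close>, the four cases are whether \<open>a\<close>
  cancels against the last and against the first letter of \<open>g\<close>.\<close>

lemma cyc_rotate1: "cyc (a # w) = cyc (w @ [a])"
proof -
  define g where "g = reduce w"
  have g: "reduced g" by (simp add: g_def)
  have ag: "reduce (a # g) = cons_reduce a g"
    by (metis g reduce_Cons reduce_reduced)
  have l: "reduce (a # w) = reduce (a # g)" by (simp add: g_def reduce_Cons)
  have r: "reduce (w @ [a]) = reduce (g @ [a])"
    by (simp add: g_def reduce_append_left)
  have "cyclic_class (cyclic_reduce (reduce (a # g))) = cyclic_class (cyclic_reduce (reduce (g @ [a])))"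
  proof (cases "g = []")
    case True then show ?thesis by simp
  next
    case ne: False
    show ?thesis
    proof (cases "last g = inv_letter a")
      case la: True
      then obtain g1 where g1: "g = g1 @ [inv_letter a]" using ne by (metis append_butlast_last_id)
      have rr: "reduce (g @ [a]) = g1" using reduce_snoc[OF g ne la] g1 by simp
      show ?thesis
      proof (cases "hd g = inv_letter a")
        \<comment> \<open>Cancellation at both ends: the results g2 a^-1 and a^-1 g2 are rotations
          of each other.\<close>
        case True
        show ?thesis
        proof (cases g1)
          case Nil
          then show ?thesis using g1 rr g by (simp add: reduce_Cons reduce_def)
        next
          case (Cons b g2)
          with True g1 have b: "b = inv_letter a" by simp
          have e: "reduce (a # g) = g2 @ [inv_letter a]"
            using ag by (simp add: g1 Cons b)
          have "cyclic_reduce (g2 @ [inv_letter a]) = g2 @ [inv_letter a]"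
            using g g1 Cons b by (intro cyclic_reduce_id) (auto simp: reduced_Cons reduced_append hd_append)
          moreover have "cyclic_reduce (inv_letter a # g2) = inv_letter a # g2"
            using g g1 Cons b by (intro cyclic_reduce_id) (auto simp: reduced_Cons reduced_append hd_append)
          ultimately show ?thesis using e rr Cons b
            by (metis append_Cons append_Nil cyclic_class_append)
        qed
      next
        case False
        \<comment> \<open>Here a g = a g1 a^-1 is reduced, and cyclic reduction strips the outer
          pair.\<close>
        then have "reduce (a # g) = a # g" using g by (intro reduce_reduced) (simp add: reduced_Cons)
        then show ?thesis using rr g1 by simp
      qed
    next
      case la: False
      then have rr: "reduce (g @ [a]) = g @ [a]"
        using g by (intro reduce_reduced) (auto simp: reduced_append reduced_Cons)
      show ?thesis
      proof (cases "hd g = inv_letter a")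
        case True
        then obtain g1 where g1: "g = inv_letter a # g1" using ne by (metis list.collapse)
        then have "reduce (a # g) = g1" using ag by simp
        then show ?thesis using rr g1 by simp
      next
        case False
        then have "reduce (a # g) = a # g" using g by (intro reduce_reduced) (simp add: reduced_Cons)
        moreover have "cyclic_reduce (a # g) = a # g" using la ne by simp
        moreover have "cyclic_reduce (g @ [a]) = g @ [a]"
          using False ne by (intro cyclic_reduce_id) (auto simp: inv_letter_swap)
        ultimately show ?thesis using rr by (metis append_Cons append_Nil cyclic_class_append)
      qed
    qed
  qed
  then show ?thesis by (simp add: cyc_def l r)
qed

lemma cyc_append: "cyc (u @ v) = cyc (v @ u)"
proof (induction u arbitrary: v)
  case (Cons a u)
  have "cyc ((a # u) @ v) = cyc (u @ (v @ [a]))" using cyc_rotate1[of a "u @ v"] by simp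
  also have "\<dots> = cyc ((v @ [a]) @ u)" by (rule Cons.IH)
  finally show ?case by simp
qed simp

lemma cyc_conj: "cyc (g @ w @ winv g) = cyc w"
proof -
  have "cyc (g @ w @ winv g) = cyc (w @ winv g @ g)" using cyc_append[of g "w @ winv g"] by simp
  also have "\<dots> = cyc w" by (intro cyc_cong) (metis append_Nil2 reduce_Nil reduce_append_right reduce_winv_left)
  finally show ?thesis .
qed

lemma cyclic_reduce_decomp: "\<exists>g. w = g @ cyclic_reduce w @ winv g"
proof (induction w rule: cyclic_reduce.induct)
  case (2 a w)
  show ?case
  proof (cases "w \<noteq> [] \<and> last w = inv_letter a")
    case True
    with 2 obtain g where "butlast w = g @ cyclic_reduce (butlast w) @ winv g" by blast
    then have "a # w = (a # g) @ cyclic_reduce (a # w) @ winv (a # g)"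
      using True by (metis (no_types) append_Cons append_assoc append_butlast_last_id cyclic_reduce.simps(2) winv_simps(2))
    then show ?thesis by blast
  next
    case False
    then show ?thesis by (intro exI[of _ "[]"]) auto
  qed
qed simp

lemma cyclically_reduced_cyclic_reduce: "reduced w \<Longrightarrow> cyclically_reduced (cyclic_reduce w)"
proof (induction w rule: cyclic_reduce.induct)
  case (2 a w)
  then show ?case
    by (auto simp: cyclically_reduced_def reduced_Cons inv_letter_swap)
       (metis append_butlast_last_id hd_append2 reduced_append butlast.simps(1) reduced_Cons)+
qed (simp add: cyclically_reduced_def)

definition core :: "word \<Rightarrow> word" where "core w = cyclic_reduce (reduce w)"

lemma cyclically_reduced_core [simp]: "cyclically_reduced (core w)"
  by (simp add: core_def cyclically_reduced_cyclic_reduce)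

lemma core_cyclically_reduced: "cyclically_reduced w \<Longrightarrow> core w = w"
  by (simp add: core_def cyclically_reduced_def reduce_reduced cyclic_reduce_id disj_commute imp_conv_disj)

lemma cyc_core: "cyc w = cyclic_class (core w)"
  by (simp add: cyc_def core_def)

lemma cyc_cyclically_reduced: "cyclically_reduced w \<Longrightarrow> cyc w = cyclic_class w"
  by (simp add: cyc_core core_cyclically_reduced)

lemma core_decomp: "\<exists>g. reduce w = g @ core w @ winv g"
  unfolding core_def by (rule cyclic_reduce_decomp)

lemma cyc_subst_core: "cyc (subst U V w) = cyc (subst U V (core w))"
proof -
  obtain g where g: "reduce w = g @ core w @ winv g" using core_decomp by blast
  have "cyc (subst U V w) = cyc (subst U V (reduce w))"
    by (intro cyc_cong) (simp add: reduce_subst_reduce)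
  also have "\<dots> = cyc (subst U V (core w))"
    by (simp add: g subst_winv cyc_conj)
  finally show ?thesis .
qed

lemma cyclic_class_eqD: "cyclic_class u = cyclic_class v \<Longrightarrow> \<exists>n. u = rotate n v"
  by (auto simp: cyclic_class_def set_eq_iff) (metis rotate0 id_apply)

lemma cyc_subst_rotate: "cyc (subst U V (rotate n w)) = cyc (subst U V w)"
proof -
  have "cyc (subst U V (drop k w @ take k w)) = cyc (subst U V w)" for k
    by (metis append_take_drop_id cyc_append subst_simps(3))
  then show ?thesis by (simp add: rotate_drop_take)
qed

lemma cyc_subst_cong: "cyc w = cyc w' \<Longrightarrow> cyc (subst U V w) = cyc (subst U V w')"
  by (metis cyc_core cyc_subst_core cyc_subst_rotate cyclic_class_eqD)

text \<open>The hypotheses say, without inverses, that \<open>g\<close> conjugates the first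
  substitution into the second; \<open>g\<close> is carried through \<open>w\<close> letter by
  letter. Substitutions that differ by an inner automorphism are thus interchangeable on cyclic
  words.\<close>

lemma cyc_subst_conj:
  assumes "reduce (g @ U) = reduce (U' @ g)" "reduce (g @ V) = reduce (V' @ g)"
  shows "cyc (subst U V w) = cyc (subst U' V' w)"
proof -
  have inv: "reduce (g @ winv A) = reduce (winv B @ g)" if "reduce (g @ A) = reduce (B @ g)" for A B
  proof -
    have "reduce (g @ winv A) = reduce (winv B @ B @ g @ winv A)" by simp
    also have "\<dots> = reduce (winv B @ (g @ A) @ winv A)"
      using that by (metis append_assoc reduce_cong)
    also have "\<dots> = reduce ((winv B @ g) @ A @ winv A)" by simp
    also have "\<dots> = reduce (winv B @ g)"
      by (metis append_Nil2 reduce_Nil reduce_append_right reduce_winv_right)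
    finally show ?thesis .
  qed
  have "reduce (g @ subst U V w) = reduce (subst U' V' w @ g)"
  proof (induction w)
    case (Cons a w)
    have a: "reduce (g @ hom_letter U V a) = reduce (hom_letter U' V' a @ g)"
      using assms inv by (cases a rule: letter_cases) auto
    have "reduce (g @ subst U V (a # w)) = reduce ((hom_letter U' V' a @ g) @ subst U V w)"
      using a by (metis append_assoc reduce_cong subst_simps(2))
    also have "\<dots> = reduce (hom_letter U' V' a @ subst U' V' w @ g)"
      using Cons.IH by (metis append_assoc reduce_cong)
    finally show ?case by simp
  qed simp
  then have "reduce (g @ subst U V w @ winv g) = reduce (subst U' V' w @ g @ winv g)"
    by (metis append_assoc reduce_cong)
  then have "reduce (g @ subst U V w @ winv g) = reduce (subst U' V' w)"
    by (metis append_Nil2 reduce_Nil reduce_append_right reduce_winv_right)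
  then show ?thesis by (metis cyc_conj cyc_cong)
qed

lemma length_reduce_le: "length (reduce w) \<le> length w"
proof (induction w)
  case (Cons a w)
  have "length (cons_reduce a (reduce w)) \<le> Suc (length (reduce w))" by (cases "reduce w") auto
  then show ?case using Cons by (simp add: reduce_Cons)
qed simp

section \<open>Bases of the free group as invertible pairs of words\<close>

definition invertible :: "word \<Rightarrow> word \<Rightarrow> bool" where
  "invertible U V \<longleftrightarrow> (\<exists>U' V'. (\<forall>w. reduce (subst U V (subst U' V' w)) = reduce w) \<and>
                             (\<forall>w. reduce (subst U' V' (subst U V w)) = reduce w))"

lemma reduce_subst_subst_eqI:
  assumes "reduce (subst U V U') = [(X1, True)]" "reduce (subst U V V') = [(X2, True)]"
  shows "reduce (subst U V (subst U' V' w)) = reduce w"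
proof -
  have "reduce (subst (subst U V U') (subst U V V') w) = reduce (subst [(X1, True)] [(X2, True)] w)"
    using assms by (intro reduce_subst_cong_images) (auto simp: reduce_def)
  then show ?thesis by (simp add: subst_subst)
qed

lemma invertibleI:
  assumes "reduce (subst U V U') = [(X1, True)]" "reduce (subst U V V') = [(X2, True)]"
    and "reduce (subst U' V' U) = [(X1, True)]" "reduce (subst U' V' V) = [(X2, True)]"
  shows "invertible U V"
  unfolding invertible_def using assms reduce_subst_subst_eqI by blast

lemma invertible_compose:
  assumes "invertible A B" "invertible U V"
  shows "invertible (subst A B U) (subst A B V)"
proof -
  obtain A' B' where AB: "\<And>w. reduce (subst A B (subst A' B' w)) = reduce w"
    "\<And>w. reduce (subst A' B' (subst A B w)) = reduce w"
    using assms(1) by (auto simp: invertible_def)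
  obtain U' V' where UV: "\<And>w. reduce (subst U V (subst U' V' w)) = reduce w"
    "\<And>w. reduce (subst U' V' (subst U V w)) = reduce w"
    using assms(2) by (auto simp: invertible_def)
  have "reduce (subst A B (subst U V (subst U' V' (subst A' B' w)))) = reduce w" for w
    by (metis AB(1) UV(1) reduce_subst_cong)
  moreover have "reduce (subst U' V' (subst A' B' (subst A B (subst U V w)))) = reduce w" for w
    by (metis AB(2) UV(2) reduce_subst_cong)
  ultimately show ?thesis
    unfolding invertible_def
    by (intro exI[of _ "subst U' V' A'"] exI[of _ "subst U' V' B'"]) (simp flip: subst_subst)
qed

lemma invertible_cong:
  assumes "invertible U V" "reduce U = reduce U'" "reduce V = reduce V'"
  shows "invertible U' V'"
proof -
  obtain A B where AB: "\<And>w. reduce (subst U V (subst A B w)) = reduce w"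
    "\<And>w. reduce (subst A B (subst U V w)) = reduce w"
    using assms(1) by (auto simp: invertible_def)
  have *: "reduce (subst U' V' w) = reduce (subst U V w)" for w
    using assms by (intro reduce_subst_cong_images) auto
  have "reduce (subst A B (subst U' V' w)) = reduce w" for w
    using AB(2)[of w] * by (metis reduce_subst_cong)
  then show ?thesis unfolding invertible_def using AB(1) * by metis
qed

lemma reduce_subst_inner: "reduce (subst (g @ U @ winv g) (g @ V @ winv g) w) = reduce (g @ subst U V w @ winv g)"
proof (induction w)
  case (Cons a w)
  have "hom_letter (g @ U @ winv g) (g @ V @ winv g) a = g @ hom_letter U V a @ winv g"
    by (cases a rule: letter_cases) auto
  then have "reduce (subst (g @ U @ winv g) (g @ V @ winv g) (a # w))
      = reduce ((g @ hom_letter U V a @ winv g) @ (g @ subst U V w @ winv g))"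
    by (simp only: subst_simps) (rule reduce_cong[OF refl Cons.IH])
  also have "\<dots> = reduce ((g @ hom_letter U V a) @ (winv g @ g @ (subst U V w @ winv g)))" by simp
  also have "\<dots> = reduce ((g @ hom_letter U V a) @ (subst U V w @ winv g))"
    by (rule reduce_cong[OF refl reduce_cancel(1)])
  finally show ?case by simp
qed simp

lemma invertible_inner: "invertible (g @ [(X1, True)] @ winv g) (g @ [(X2, True)] @ winv g)"
proof (rule invertibleI[of _ _ "winv g @ [(X1, True)] @ g" "winv g @ [(X2, True)] @ g"])
  have *: "reduce (g @ (winv g @ [a] @ g) @ winv g) = [a]" for g and a :: letter
  proof -
    have "reduce (g @ (winv g @ [a] @ g) @ winv g) = reduce (g @ winv g @ ([a] @ g @ winv g))" by simp
    also have "\<dots> = reduce ([a] @ g @ winv g)" by (rule reduce_cancel)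
    also have "\<dots> = reduce ([a] @ [])" by (rule reduce_cong) simp_all
    also have "\<dots> = [a]" by (simp add: reduce_def)
    finally show ?thesis .
  qed
  have i: "reduce (subst (g @ [(X1, True)] @ winv g) (g @ [(X2, True)] @ winv g) w) = reduce (g @ w @ winv g)" for g w
    using reduce_subst_inner[of g "[(X1, True)]" "[(X2, True)]" w] by simp
  have j: "reduce (subst (winv g @ [(X1, True)] @ g) (winv g @ [(X2, True)] @ g) w) = reduce (winv g @ w @ g)" for w
    using i[of "winv g" w] by simp
  show "reduce (subst (g @ [(X1, True)] @ winv g) (g @ [(X2, True)] @ winv g) (winv g @ [(X1, True)] @ g)) = [(X1, True)]"
    "reduce (subst (g @ [(X1, True)] @ winv g) (g @ [(X2, True)] @ winv g) (winv g @ [(X2, True)] @ g)) = [(X2, True)]"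
    unfolding i by (rule *)+
  show "reduce (subst (winv g @ [(X1, True)] @ g) (winv g @ [(X2, True)] @ g) (g @ [(X1, True)] @ winv g)) = [(X1, True)]"
    "reduce (subst (winv g @ [(X1, True)] @ g) (winv g @ [(X2, True)] @ g) (g @ [(X2, True)] @ winv g)) = [(X2, True)]"
    unfolding j using *[of "winv g" "(X1, True)"] *[of "winv g" "(X2, True)"] by (simp_all only: winv_simps)
qed

lemma invertible_conj:
  "invertible U V \<Longrightarrow> invertible (reduce (g @ U @ winv g)) (reduce (g @ V @ winv g))"
  by (rule invertible_cong[OF invertible_compose[OF invertible_inner[of g]]])
     (use reduce_subst_inner[of g "[(X1, True)]" "[(X2, True)]"] in auto)

lemma invertible_swap: "invertible U V \<Longrightarrow> invertible V U"
  using invertible_compose[of U V "[(X2, True)]" "[(X1, True)]"]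
    invertibleI[of "[(X2, True)]" "[(X1, True)]" "[(X2, True)]" "[(X1, True)]"]
  by (auto simp: reduce_def)

lemma invertible_winv: "invertible U V \<Longrightarrow> invertible (winv U) V"
  using invertible_compose[of U V "[(X1, False)]" "[(X2, True)]"]
    invertibleI[of "[(X1, False)]" "[(X2, True)]" "[(X1, False)]" "[(X2, True)]"]
  by (auto simp: reduce_def)

lemma invertible_transvection: "invertible [(X1, True), (X2, True)] [(X2, True)]"
  by (rule invertibleI[of _ _ "[(X1, True), (X2, False)]" "[(X2, True)]"]) (auto simp: reduce_def)

lemma invertible_mult: "invertible U V \<Longrightarrow> invertible (reduce (U @ V)) V"
  by (rule invertible_cong[OF invertible_compose[OF _ invertible_transvection]]) auto

lemma invertible_nonempty:
  assumes "invertible U V" "reduced U" "reduced V"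
  shows "U \<noteq> []" "V \<noteq> []"
proof -
  obtain A B where AB: "\<And>w. reduce (subst A B (subst U V w)) = reduce w"
    using assms(1) by (auto simp: invertible_def)
  show "U \<noteq> []" using AB[of "[(X1, True)]"] by (auto simp: reduce_def)
  show "V \<noteq> []" using AB[of "[(X2, True)]"] by (auto simp: reduce_def)
qed

section \<open>Nielsen reduction\<close>

text \<open>The Gromov product at the identity in the Cayley tree; for reduced words it counts the
  letters cancelled in u^-1 v.\<close>

fun common_prefix :: "word \<Rightarrow> word \<Rightarrow> nat" where
  "common_prefix (a # u) (b # v) = (if a = b then Suc (common_prefix u v) else 0)"
| "common_prefix _ _ = 0"

lemma common_prefix_ge:
  "k \<le> common_prefix u v \<longleftrightarrow> k \<le> length u \<and> k \<le> length v \<and> take k u = take k v"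
proof (induction u v arbitrary: k rule: common_prefix.induct)
  case (1 a u b v)
  then show ?case by (cases k) auto
qed auto

lemma common_prefix_commute: "common_prefix u v = common_prefix v u"
  by (induction u v rule: common_prefix.induct) auto

text \<open>The ultrametric inequality of a tree: among the three pairwise prefix lengths the two
  smallest agree.\<close>

lemma common_prefix_isosceles:
  assumes "common_prefix x y < common_prefix z y"
  shows "common_prefix x z = common_prefix x y"
proof (rule antisym)
  have *: "k \<le> common_prefix x y" if "k \<le> common_prefix x z" "k \<le> common_prefix z y" for k x y z
    using that unfolding common_prefix_ge by auto
  show "common_prefix x y \<le> common_prefix x z"
    using *[of "common_prefix x y" x y z] assms by (simp add: common_prefix_commute)
  have "\<not> Suc (common_prefix x y) \<le> common_prefix x z"
    using *[of "Suc (common_prefix x y)" x z y] assms by auto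
  then show "common_prefix x z \<le> common_prefix x y" by simp
qed

lemma reduce_winv_append:
  assumes "reduced u" "reduced v"
  shows "reduce (winv u @ v) = winv (drop (common_prefix u v) u) @ drop (common_prefix u v) v"
  using assms
proof (induction u v rule: common_prefix.induct)
  case (1 a u b v)
  show ?case
  proof (cases "a = b")
    case True
    have "reduce (winv u @ [inv_letter b] @ [b] @ v) = reduce (winv u @ v)"
    proof (rule reduce_cong)
      show "reduce ([inv_letter b] @ [b] @ v) = reduce v"
        using reduce_cancel(1)[of "[b]" v] by simp
    qed simp
    then show ?thesis using 1 True by (simp add: reduced_Cons)
  next
    case False
    then have "reduced (winv (a # u) @ b # v)"
      using 1(2,3) reduced_winv[of "a # u"] by (subst reduced_append) auto
    then show ?thesis using False by (simp add: reduce_reduced)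
  qed
qed (auto simp: reduce_reduced reduced_append)

text \<open>If half of X cancelled in X X, reflection about the middle would invert letters: two
  inverse neighbours in the middle if the length is even, a self-inverse letter if it is
  odd.\<close>

lemma common_prefix_winv_self:
  assumes "reduced X" "X \<noteq> []"
  shows "2 * common_prefix (winv X) X < length X"
proof (rule ccontr)
  define n k where "n = length X" and "k = common_prefix (winv X) X"
  assume "\<not> 2 * common_prefix (winv X) X < length X"
  then have k: "2 * k \<ge> n" by (simp add: k_def n_def)
  have n: "n > 0" using assms by (simp add: n_def)
  have *: "X ! i = inv_letter (X ! (n - 1 - i))" if "i < k" for i
  proof -
    have kp: "k \<le> length X" "take k (winv X) = take k X"
      using common_prefix_ge[of k "winv X" X] by (auto simp: k_def)
    then have "X ! i = winv X ! i" using that by (metis nth_take)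
    then show ?thesis using that kp(1) by (simp add: winv_def rev_nth n_def)
  qed
  show False
  proof (cases "even n")
    case True
    then obtain m where m: "n = 2 * Suc m" using n by (metis dvd_def gr0_implies_Suc nat_0_less_mult_iff)
    have "X ! m = inv_letter (X ! Suc m)"
      using *[of m] m k by simp
    moreover have "X ! Suc m \<noteq> inv_letter (X ! m)"
      using assms(1) m unfolding reduced_def successively_conv_nth by (simp add: n_def)
    ultimately show False by simp
  next
    case False
    then obtain m where m: "n = 2 * m + 1" by (blast elim: oddE)
    then show False using *[of m] k by (simp add: algebra_simps)
  qed
qed

section \<open>Nielsen reduced pairs\<close>

abbreviation cancel :: "word \<Rightarrow> word \<Rightarrow> letter \<Rightarrow> letter \<Rightarrow> nat" where
  "cancel U V a b \<equiv> common_prefix (hom_letter U V (inv_letter a)) (hom_letter U V b)"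

text \<open>Nielsen's condition on triples, with cancellation measured by common prefixes: in a
  product of images, the two neighbours of \<open>b\<close> together never consume the whole image
  of \<open>b\<close>.\<close>

definition nielsen_reduced :: "word \<Rightarrow> word \<Rightarrow> bool" where
  "nielsen_reduced U V \<longleftrightarrow> (\<forall>a b c. b \<noteq> inv_letter a \<longrightarrow> c \<noteq> inv_letter b \<longrightarrow>
     cancel U V a b + cancel U V b c < length (hom_letter U V b))"

lemma winv_drop: "winv (drop k w) = take (length w - k) (winv w)"
  by (simp add: winv_def rev_drop flip: drop_map)

lemma take_winv: "take k (winv w) = winv (drop (length w - k) w)"
  by (simp add: winv_def take_rev drop_map)

lemma reduced_hom_letter: "reduced U \<Longrightarrow> reduced V \<Longrightarrow> reduced (hom_letter U V a)"
  by (cases a rule: letter_cases) auto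

text \<open>Each letter of \<open>b # w\<close> leaves at least one letter in the product. The
  induction is strengthened by a possible predecessor \<open>z\<close>: the reduced product shares
  more of its beginning with the image of \<open>b\<close> than \<open>z\<close> can cancel, so the
  cancellation with \<open>z\<close> is decided by \<open>b\<close> alone.\<close>

lemma nielsen_reduced_length:
  assumes "reduced U" "reduced V" "nielsen_reduced U V" "reduced (b # w)"
  defines "P \<equiv> reduce (subst U V (b # w))"
  shows "z \<noteq> inv_letter b \<Longrightarrow>
     Suc (length w) + cancel U V z b \<le> length P \<and>
     cancel U V z b < common_prefix P (hom_letter U V b)"
  using assms(4) unfolding P_def
proof (induction w arbitrary: b z)
  case Nil
  let ?h = "hom_letter U V"
  have "cancel U V z b + cancel U V b b < length (?h b)"
    using assms(3)[unfolded nielsen_reduced_def, rule_format, of b z b] Nil inv_letter_swap[of b z] by simp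
  moreover have "common_prefix (?h b) (?h b) = length (?h b)"
    using common_prefix_ge[of "length (?h b)" "?h b" "?h b"] common_prefix_ge[of "common_prefix (?h b) (?h b)" "?h b" "?h b"]
    by auto
  ultimately show ?case by (simp add: reduce_reduced reduced_hom_letter assms(1,2))
next
  case (Cons c w)
  let ?h = "hom_letter U V"
  define P where "P = reduce (subst U V (c # w))"
  define k where "k = cancel U V b c"
  have bc: "c \<noteq> inv_letter b" "b \<noteq> inv_letter c" "reduced (c # w)"
    using Cons.prems(2) by (auto simp: reduced_Cons)
  have IH: "Suc (length w) + k \<le> length P" "k < common_prefix P (?h c)"
    using Cons.IH[OF bc(2,3)] by (auto simp: P_def k_def)
  \<comment> \<open>The inverse of the image of \<open>b\<close> leaves the image of
    \<open>c\<close> before \<open>P\<close> does, so it cancels exactly \<open>k\<close> letters of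
    \<open>P\<close>.\<close>
  have iso: "common_prefix (?h (inv_letter b)) P = k"
    using common_prefix_isosceles[of "?h (inv_letter b)" "?h c" P] IH(2) by (simp add: k_def)
  have "reduce (subst U V (b # c # w)) = reduce (winv (?h (inv_letter b)) @ P)"
    unfolding P_def by (simp add: hom_letter_inv reduce_append_right)
  also have "\<dots> = winv (drop k (?h (inv_letter b))) @ drop k P"
    using reduce_winv_append[of "?h (inv_letter b)" P] iso by (simp add: P_def reduced_hom_letter assms)
  also have "winv (drop k (?h (inv_letter b))) = take (length (?h b) - k) (?h b)"
    by (simp add: hom_letter_inv winv_drop)
  finally have P': "reduce (subst U V (b # c # w)) = take (length (?h b) - k) (?h b) @ drop k P" .
  have N: "cancel U V z b + k < length (?h b)"
    using assms(3)[unfolded nielsen_reduced_def, rule_format, of b z c] bc(1) Cons.prems(1)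
      inv_letter_swap[of b z] by (simp add: k_def)
  have "length (?h b) - k \<le> common_prefix (reduce (subst U V (b # c # w))) (?h b)"
    unfolding common_prefix_ge P' by simp
  moreover have "length (reduce (subst U V (b # c # w))) = length (?h b) - k + (length P - k)"
    unfolding P' by simp
  ultimately show ?case using N IH(1) by (simp only: list.size) linarith
qed

lemma winv_eq_singleton: "winv w = [a] \<longleftrightarrow> w = [inv_letter a]"
  by (metis append_Nil winv_simps(1,2,4))

text \<open>Every generator is the image of some word, and by \<open>nielsen_reduced_length\<close>
  that word is a single letter.\<close>

lemma nielsen_reduced_letters:
  assumes "reduced U" "reduced V" "nielsen_reduced U V" "invertible U V"
  shows "\<exists>a b. U = [a] \<and> V = [b] \<and> fst a \<noteq> fst b"
proof -
  obtain A B where AB: "\<And>w. reduce (subst U V (subst A B w)) = reduce w"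
    "\<And>w. reduce (subst A B (subst U V w)) = reduce w"
    using assms(4) by (auto simp: invertible_def)
  have *: "\<exists>b. hom_letter U V b = [(g, True)]" for g
  proof -
    define w where "w = reduce (subst A B [(g, True)])"
    have e: "reduce (subst U V w) = [(g, True)]"
      by (simp add: w_def reduce_subst_reduce AB del: subst_simps) (simp add: reduce_def)
    then obtain b v where w: "w = b # v" by (cases w) auto
    have "Suc (length v) \<le> length (reduce (subst U V (b # v)))"
      using nielsen_reduced_length[OF assms(1-3), of b v b] w reduced_reduce[of "subst A B [(g, True)]", folded w_def] by simp
    then have "v = []" using e w by simp
    then have "hom_letter U V b = [(g, True)]" using e w by (simp add: reduce_reduced reduced_hom_letter assms)
    then show ?thesis by blast
  qed
  obtain a b where "hom_letter U V a = [(X1, True)]" "hom_letter U V b = [(X2, True)]"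
    using * by metis
  then show ?thesis
    by (cases a rule: letter_cases; cases b rule: letter_cases) (simp_all add: winv_eq_singleton)
qed

text \<open>A pair that no product shortens but that is not Nielsen reduced is \<open>U = q m p\<^sup>-\<^sup>1\<close>, \<open>V = p q\<^sup>-\<^sup>1\<close>
  with \<open>p\<close> and \<open>q\<close> of equal length. Conjugating by \<open>p\<close> turns \<open>(VU, V)\<close> into \<open>(m, q\<^sup>-\<^sup>1p)\<close>, which is
  shorter; admitting conjugation thus makes the usual ordering of words dispensable.\<close>

lemma nielsen_induct [consumes 3, case_names swap inverse mult conj letters]:
  assumes "invertible U V" "reduced U" "reduced V"
    and swap: "\<And>U V. \<Phi> V U \<Longrightarrow> \<Phi> U V"
    and inverse: "\<And>U V. \<Phi> (winv U) V \<Longrightarrow> \<Phi> U V"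
    and mult: "\<And>U V. \<Phi> (reduce (U @ V)) V \<Longrightarrow> \<Phi> U V"
    and conj: "\<And>U V g. \<Phi> (reduce (g @ U @ winv g)) (reduce (g @ V @ winv g)) \<Longrightarrow> \<Phi> U V"
    and letters: "\<And>a b. fst a \<noteq> fst b \<Longrightarrow> \<Phi> [a] [b]"
  shows "\<Phi> U V"
  using assms(1-3)
proof (induction "length U + length V" arbitrary: U V rule: less_induct)
  case less
  let ?h = "hom_letter U V" and ?c = "cancel U V"
  note inv = less.prems(1) and red = less.prems(2,3)
  have rh: "reduced (?h a)" for a using red by (rule reduced_hom_letter)
  have ne: "?h a \<noteq> []" for a
    using invertible_nonempty[OF less.prems] by (cases a rule: letter_cases) auto
  have len_inv: "length (?h (inv_letter a)) = length (?h a)" for a by (simp add: hom_letter_inv)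
  have tot: "length (?h a) + length (?h b) = length U + length V" if "fst a \<noteq> fst b" for a b
    using that by (cases a rule: letter_cases; cases b rule: letter_cases) auto
  have inverse': "\<Phi> U (winv V) \<Longrightarrow> \<Phi> U V" for U V using swap inverse by blast
  have pair: "\<Phi> U V" if "fst a \<noteq> fst b" "\<Phi> (?h a) (?h b)" for a b
    using that swap[of V U] inverse[of U V] inverse'[of U V] inverse[of V U] inverse'[of V U]
      inverse[of U "winv V"] inverse[of V "winv U"]
    by (cases a rule: letter_cases; cases b rule: letter_cases) simp_all
  have pair_inv: "invertible (?h a) (?h b)" if "fst a \<noteq> fst b" for a b
    using that inv invertible_swap[of U V] invertible_winv[of U V] invertible_winv[of V U]
      invertible_swap[of V "winv U"] invertible_swap[of U "winv V"] invertible_swap[of "winv V" U]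
      invertible_swap[of "winv U" V] invertible_winv[of U "winv V"] invertible_winv[of V "winv U"]
    by (cases a rule: letter_cases; cases b rule: letter_cases) simp_all
  have clen: "length (reduce (?h a @ ?h b)) + 2 * ?c a b = length (?h a) + length (?h b)" for a b
  proof -
    have "?c a b \<le> length (?h (inv_letter a))" "?c a b \<le> length (?h b)"
      using common_prefix_ge[of "?c a b" "?h (inv_letter a)" "?h b"] by auto
    then show ?thesis
      using reduce_winv_append[OF rh[of "inv_letter a"] rh[of b]] by (simp add: hom_letter_inv)
  qed
  show ?case
  proof (cases "\<exists>a b. fst a \<noteq> fst b \<and> 2 * ?c a b > length (?h b)")
    case True
    then obtain a b where ab: "fst a \<noteq> fst b" "2 * ?c a b > length (?h b)" by blast
    \<comment> \<open>More than half of the image of \<open>b\<close> cancels, so the product is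
      shorter than the image of \<open>a\<close>.\<close>
    have "\<Phi> (reduce (?h a @ ?h b)) (?h b)"
      by (rule less.hyps) (use clen[of a b] ab tot[OF ab(1)] invertible_mult[OF pair_inv[OF ab(1)]] rh in auto)
    then show ?thesis using mult pair ab(1) by blast
  next
    case False
    then have N1: "2 * ?c a b \<le> length (?h b)" if "fst a \<noteq> fst b" for a b using that by (meson not_le)
    have c_inv: "?c (inv_letter b) (inv_letter a) = ?c a b" for a b
      by (simp add: common_prefix_commute)
    have N1': "2 * ?c a b \<le> length (?h a)" if "fst a \<noteq> fst b" for a b
      using N1[of "inv_letter b" "inv_letter a"] that c_inv len_inv by (simp add: inv_letter_def)
    have self: "2 * ?c a a < length (?h a)" for a
      using common_prefix_winv_self[OF rh ne, of a] by (simp add: hom_letter_inv)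
    show ?thesis
    proof (cases "nielsen_reduced U V")
      case True
      then show ?thesis using nielsen_reduced_letters[OF red True inv] letters by auto
    next
      case False
      then obtain a b z where abz: "b \<noteq> inv_letter a" "z \<noteq> inv_letter b" "?c a b + ?c b z \<ge> length (?h b)"
        unfolding nielsen_reduced_def by (meson not_le)
      have eq: "a = b" if "fst a = fst b" "b \<noteq> inv_letter a" for a b :: letter
        using that by (cases a; cases b) auto
      \<comment> \<open>If \<open>a = b\<close>, less than half cancels on the left by
        \<open>self\<close> and at most half on the right, contrary to the choice of the
        triple.\<close>
      have ab: "fst a \<noteq> fst b"
      proof
        assume "fst a = fst b"
        then have "a = b" using eq abz(1) by blast
        moreover have "2 * ?c b z \<le> length (?h b)"
          using eq[of b z] abz(2) self[of b] N1'[of b z] by (cases "fst b = fst z") auto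
        ultimately show False using self[of b] abz(3) by simp
      qed
      have bz: "fst b \<noteq> fst z"
      proof
        assume "fst b = fst z"
        then have "b = z" using eq abz(2) by blast
        then show False using self[of b] N1[OF ab] abz(3) by auto
      qed
      define k where "k = ?c a b"
      \<comment> \<open>Each side cancels at most half and together they cancel everything, so each
        cancels exactly half.\<close>
      have k: "length (?h b) = 2 * k" "?c b z = k"
        using N1[OF ab] N1'[OF bz] abz(3) by (auto simp: k_def)
      have k0: "k > 0" using ne[of b] k(1) by (cases k) auto
      have t1: "take k (winv (?h a)) = take k (?h b)"
        using common_prefix_ge[of k "?h (inv_letter a)" "?h b"] by (simp add: k_def hom_letter_inv)
      have t2: "take k (winv (?h b)) = take k (?h z)"
        using common_prefix_ge[of k "?h (inv_letter b)" "?h z"] k by (simp add: hom_letter_inv)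
      \<comment> \<open>Otherwise the image of \<open>b\<close> and its inverse would share their
        first half.\<close>
      have "z \<noteq> inv_letter a"
      proof
        assume "z = inv_letter a"
        then have "k \<le> ?c b b" unfolding common_prefix_ge using t1 t2 k by (simp add: hom_letter_inv)
        then show False using self[of b] k by simp
      qed
      moreover have "fst z = fst a" using ab bz by (cases "fst a"; cases "fst b"; cases "fst z") auto
      ultimately have za: "z = a" using eq[of a z] by auto
      define p q where "p = take k (?h b)" and "q = take k (?h a)"
      have Y: "?h b = p @ winv q"
      proof -
        have "winv (drop k (?h b)) = take k (winv (?h b))"
          using k by (simp add: winv_drop)
        then have "winv (drop k (?h b)) = q" using t2 za by (simp add: q_def)
        then have "drop k (?h b) = winv q" by (metis winv_simps(4))
        then show ?thesis unfolding p_def by (metis append_take_drop_id)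
      qed
      have ka: "2 * k \<le> length (?h a)" using N1'[OF ab] by (simp add: k_def)
      obtain m where X: "?h a = q @ m @ winv p"
      proof -
        define X' where "X' = drop k (?h a)"
        have "take k (winv (?h a)) = winv (drop (length X' - k) X')"
          using ka by (simp add: X'_def take_winv add.commute)
        then have "drop (length X' - k) X' = winv p" using t1 by (metis p_def winv_simps(4))
        then have "X' = take (length X' - k) X' @ winv p" by (metis append_take_drop_id)
        then have "?h a = q @ take (length X' - k) X' @ winv p"
          unfolding q_def X'_def by (metis append_take_drop_id)
        then show ?thesis using that by blast
      qed
      have lens: "length p = k" "length q = k" using k ka by (auto simp: p_def q_def)
      \<comment> \<open>Inverses are taken because \<open>mult\<close> multiplies on the right: this
        product is the inverse of the left multiple of the image of \<open>a\<close> by that of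
        \<open>b\<close>.\<close>
      let ?W = "reduce (?h (inv_letter a) @ ?h (inv_letter b))"
      have iab: "fst (inv_letter a) \<noteq> fst (inv_letter b)" using ab by (simp add: inv_letter_def)
      let ?U = "reduce (winv p @ ?W @ winv (winv p))" and ?V = "reduce (winv p @ ?h (inv_letter b) @ winv (winv p))"
      have e1: "?U = reduce (winv m)"
      proof -
        have "?U = reduce (winv p @ (?h (inv_letter a) @ ?h (inv_letter b)) @ p)"
          by (intro reduce_cong) (auto simp: reduce_append_left)
        also have "\<dots> = reduce (winv p @ p @ (winv m @ winv q @ q @ winv p @ p))"
          by (simp add: X Y hom_letter_inv)
        also have "\<dots> = reduce (winv m @ (winv q @ q @ (winv p @ p)))" by (simp only: reduce_cancel append_assoc)
        also have "\<dots> = reduce (winv m @ [])" by (intro reduce_cong) auto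
        finally show ?thesis by simp
      qed
      have e2: "?V = reduce (winv p @ q)"
      proof -
        have "?V = reduce (winv p @ q @ (winv p @ p))" by (simp add: Y hom_letter_inv)
        also have "\<dots> = reduce (winv p @ q @ [])" by (intro reduce_cong) auto
        finally show ?thesis by simp
      qed
      have "\<Phi> ?U ?V"
      proof (rule less.hyps)
        \<comment> \<open>The new total is at most the joint length of \<open>q\<close>,
          \<open>m\<close> and \<open>p\<close>, that is, the length of the image of
          \<open>a\<close>.\<close>
        have "length ?U + length ?V \<le> length (?h a)"
          using e1 e2 length_reduce_le[of "winv m"] length_reduce_le[of "winv p @ q"] X lens by simp
        then show "length ?U + length ?V < length U + length V"
          using tot[OF ab] k k0 by simp
        show "invertible ?U ?V"
          using invertible_conj[OF invertible_mult[OF pair_inv[OF iab]], of "winv p"] by simp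
      qed auto
      then show ?thesis using conj mult pair[OF iab] by blast
    qed
  qed
qed

section \<open>Automorphisms and orbits\<close>

lemma carrier_F2: "carrier F2 = {w. reduced w}"
  by (simp add: F2_def)

lemma mult_F2: "u \<otimes>\<^bsub>F2\<^esub> v = reduce (u @ v)"
  by (simp add: F2_def)

lemma reduced_singleton [simp]: "reduced [a]"
  by (simp add: reduced_def)

lemma hom_F2_eq_subst:
  assumes "\<psi> \<in> hom F2 F2"
  shows "\<exists>U V. reduced U \<and> reduced V \<and> (\<forall>w. reduced w \<longrightarrow> \<psi> w = reduce (subst U V w))"
proof -
  have red: "reduced (\<psi> w)" if "reduced w" for w
    using assms that by (auto simp: hom_def carrier_F2)
  have mult: "\<psi> (reduce (u @ v)) = reduce (\<psi> u @ \<psi> v)" if "reduced u" "reduced v" for u v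
    using assms that by (auto simp: hom_def carrier_F2 mult_F2)
  have Nil: "\<psi> [] = []"
    using hom_one[OF assms group_F2 group_F2] by (simp add: F2_def)
  have inv: "\<psi> [inv_letter a] = winv (\<psi> [a])" for a
  proof -
    have "reduce (\<psi> [inv_letter a] @ \<psi> [a]) = []"
      using mult[of "[inv_letter a]" "[a]"] Nil by (simp add: reduce_Cons)
    have "\<psi> [inv_letter a] = reduce (\<psi> [inv_letter a] @ [])" by (simp add: reduce_reduced red)
    also have "\<dots> = reduce (\<psi> [inv_letter a] @ (\<psi> [a] @ winv (\<psi> [a])))"
      by (rule reduce_cong) simp_all
    also have "\<dots> = reduce ((\<psi> [inv_letter a] @ \<psi> [a]) @ winv (\<psi> [a]))" by simp
    also have "\<dots> = reduce ([] @ winv (\<psi> [a]))"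
      by (rule reduce_cong) (simp_all add: \<open>reduce (\<psi> [inv_letter a] @ \<psi> [a]) = []\<close>)
    finally show ?thesis by (simp add: reduce_reduced red)
  qed
  let ?U = "\<psi> [(X1, True)]" and ?V = "\<psi> [(X2, True)]"
  have h: "hom_letter ?U ?V a = \<psi> [a]" for a
    using inv[of "(X1, True)"] inv[of "(X2, True)"] by (cases a rule: letter_cases) auto
  have "reduced w \<Longrightarrow> \<psi> w = reduce (subst ?U ?V w)" for w
  proof (induction w)
    case (Cons a w)
    have "\<psi> (a # w) = \<psi> (reduce ([a] @ w))" using Cons.prems by (simp add: reduce_reduced)
    also have "\<dots> = reduce (\<psi> [a] @ \<psi> w)" using Cons.prems by (intro mult) (simp_all add: reduced_Cons)
    also have "\<dots> = reduce (\<psi> [a] @ subst ?U ?V w)"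
      using Cons by (intro reduce_cong) (auto simp: reduced_Cons)
    finally show ?case by (simp add: h)
  qed (simp add: Nil)
  then show ?thesis using red by (metis reduced_singleton)
qed

lemma auto_F2_subst:
  assumes "\<psi> \<in> auto F2"
  shows "\<exists>U V. reduced U \<and> reduced V \<and> invertible U V \<and> (\<forall>w. reduced w \<longrightarrow> \<psi> w = reduce (subst U V w))"
proof -
  have hom: "\<psi> \<in> hom F2 F2" and bij: "bij_betw \<psi> (carrier F2) (carrier F2)"
    using assms by (auto simp: auto_def Bij_def)
  let ?i = "inv_into (carrier F2) \<psi>"
  have "?i \<in> iso F2 F2"
    using group.iso_set_sym[OF group_F2] hom bij by (auto simp: iso_def)
  then have hom': "?i \<in> hom F2 F2" by (simp add: iso_def)
  obtain U V where UV: "reduced U" "reduced V" "\<And>w. reduced w \<Longrightarrow> \<psi> w = reduce (subst U V w)"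
    using hom_F2_eq_subst[OF hom] by blast
  obtain A B where AB: "\<And>w. reduced w \<Longrightarrow> ?i w = reduce (subst A B w)"
    using hom_F2_eq_subst[OF hom'] by blast
  have "reduce (subst U V (subst A B w)) = reduce w" for w
  proof -
    have "\<psi> (?i (reduce w)) = reduce w"
      using bij by (intro bij_betw_inv_into_right) (auto simp: carrier_F2)
    then show ?thesis
      by (simp add: AB UV) (simp add: reduce_subst_reduce reduce_subst_cong[OF reduce_subst_reduce])
  qed
  moreover have "reduce (subst A B (subst U V w)) = reduce w" for w
  proof -
    have "?i (\<psi> (reduce w)) = reduce w"
      using bij by (intro bij_betw_inv_into_left) (auto simp: carrier_F2)
    then show ?thesis
      by (simp add: AB UV) (simp add: reduce_subst_reduce reduce_subst_cong[OF reduce_subst_reduce])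
  qed
  ultimately have "invertible U V" unfolding invertible_def by blast
  then show ?thesis using UV by blast
qed

lemma invertible_auto:
  assumes "invertible U V"
  shows "\<exists>\<psi>\<in>auto F2. \<forall>w. reduced w \<longrightarrow> \<psi> w = reduce (subst U V w)"
proof -
  obtain A B where AB: "\<And>w. reduce (subst U V (subst A B w)) = reduce w"
    "\<And>w. reduce (subst A B (subst U V w)) = reduce w"
    using assms by (auto simp: invertible_def)
  \<comment> \<open>\<open>auto\<close> consists of extensional functions, hence the restriction to
    the carrier.\<close>
  let ?\<psi> = "\<lambda>w\<in>carrier F2. reduce (subst U V w)"
  have "?\<psi> \<in> hom F2 F2"
  proof (rule homI)
    fix u v assume "u \<in> carrier F2" "v \<in> carrier F2"
    then show "?\<psi> (u \<otimes>\<^bsub>F2\<^esub> v) = ?\<psi> u \<otimes>\<^bsub>F2\<^esub> ?\<psi> v"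
      by (simp add: carrier_F2 mult_F2 reduce_subst_reduce reduce_append_left reduce_append_right)
  qed (simp add: carrier_F2)
  moreover have "bij_betw ?\<psi> (carrier F2) (carrier F2)"
    by (rule bij_betw_byWitness[of _ "\<lambda>w. reduce (subst A B w)"])
       (auto simp: carrier_F2 reduce_subst_reduce AB reduce_reduced)
  ultimately have "?\<psi> \<in> auto F2" by (auto simp: auto_def Bij_def)
  then show ?thesis by (rule bexI[rotated]) (simp add: carrier_F2)
qed

section \<open>Orbits of cyclic words in terms of substitutions\<close>

lemma rotate_append_exists: "\<exists>u v. w = u @ v \<and> rotate n w = v @ u"
  by (metis append_take_drop_id rotate_drop_take)

lemma cyclically_reduced_rotate: "cyclically_reduced w \<Longrightarrow> cyclically_reduced (rotate n w)"
proof -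
  assume w: "cyclically_reduced w"
  obtain u v where uv: "w = u @ v" "rotate n w = v @ u" using rotate_append_exists by blast
  have "cyclically_reduced (v @ u)"
    using w inv_letter_swap[of "last v" "hd u"] inv_letter_swap[of "last u" "hd v"] unfolding uv(1)
    by (cases "u = []"; cases "v = []") (auto simp: cyclically_reduced_def reduced_append)
  then show ?thesis by (simp add: uv(2))
qed

lemma representative_cyclic_class: "\<exists>n. representative (cyclic_class w) = rotate n w"
proof -
  have "representative (cyclic_class w) \<in> cyclic_class w"
    unfolding representative_def by (rule someI[of _ w]) (auto simp: cyclic_class_def intro: exI[of _ 0])
  then show ?thesis by (auto simp: cyclic_class_def)
qed

lemma cyclic_length_cyclic_class: "cyclic_length (cyclic_class w) = length w"
  using representative_cyclic_class[of w] by (auto simp: cyclic_length_def)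

lemma length_filter_rotate: "length (filter P (rotate n w)) = length (filter P w)"
  by (metis rotate_append_exists add.commute filter_append length_append)

lemma occurrences_cyclic_class: "occurrences g (cyclic_class w) = length (filter (\<lambda>a. fst a = g) w)"
  using representative_cyclic_class[of w] by (auto simp: occurrences_def length_filter_rotate)

lemma Orb_cyclic_class:
  assumes "cyclically_reduced w"
  shows "Orb (cyclic_class w) = {cyc (subst U V w) | U V. invertible U V}"
proof -
  obtain n where n: "representative (cyclic_class w) = rotate n w"
    using representative_cyclic_class by blast
  have red: "reduced (rotate n w)"
    using cyclically_reduced_rotate[OF assms] by (simp add: cyclically_reduced_def)
  have act: "act \<psi> (cyclic_class w) = cyc (subst U V w)"
    if "\<And>w. reduced w \<Longrightarrow> \<psi> w = reduce (subst U V w)" for \<psi> U V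
    using that[OF red] cyc_subst_rotate[of U V n w] by (simp add: act_def n cyc_def)
  show ?thesis
  proof (rule Set.set_eqI, rule iffI)
    fix v assume "v \<in> Orb (cyclic_class w)"
    then obtain \<psi> where \<psi>: "\<psi> \<in> auto F2" "v = act \<psi> (cyclic_class w)" by (auto simp: Orb_def)
    obtain U V where UV: "invertible U V" "\<And>w. reduced w \<Longrightarrow> \<psi> w = reduce (subst U V w)"
      using auto_F2_subst[OF \<psi>(1)] by metis
    have "v = cyc (subst U V w)" using act[OF UV(2)] \<psi>(2) by simp
    then show "v \<in> {cyc (subst U V w) | U V. invertible U V}" using UV(1) by auto
  next
    fix v assume "v \<in> {cyc (subst U V w) | U V. invertible U V}"
    then obtain U V where UV: "invertible U V" "v = cyc (subst U V w)" by blast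
    obtain \<psi> where \<psi>: "\<psi> \<in> auto F2" "\<And>w. reduced w \<Longrightarrow> \<psi> w = reduce (subst U V w)"
      using invertible_auto[OF UV(1)] by metis
    have "v = act \<psi> (cyclic_class w)" using act[OF \<psi>(2)] UV(2) by simp
    then show "v \<in> Orb (cyclic_class w)" using \<psi>(1) by (auto simp: Orb_def)
  qed
qed

section \<open>Signed permutations of the generators\<close>

text \<open>The eight automorphisms that permute the letters, kept as functions on letters so that
  \<open>map\<close> commutes with free and cyclic reduction.\<close>

definition signed_perm :: "(letter \<Rightarrow> letter) \<Rightarrow> bool" where
  "signed_perm \<pi> \<longleftrightarrow> (\<forall>a. \<pi> (inv_letter a) = inv_letter (\<pi> a)) \<and> fst (\<pi> (X1, True)) \<noteq> fst (\<pi> (X2, True))"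

lemma signed_perm_inv: "signed_perm \<pi> \<Longrightarrow> \<pi> (inv_letter a) = inv_letter (\<pi> a)"
  unfolding signed_perm_def by blast

lemma signed_perm_False:
  "signed_perm \<pi> \<Longrightarrow> \<pi> (g, False) = inv_letter (\<pi> (g, True))"
  using signed_perm_inv[of \<pi> "(g, True)"] by simp

lemma signed_perm_fst: "signed_perm \<pi> \<Longrightarrow> fst (\<pi> a) = fst (\<pi> b) \<longleftrightarrow> fst a = fst b"
  by (cases a rule: letter_cases; cases b rule: letter_cases)
     (auto simp: signed_perm_False inv_letter_def signed_perm_def[of \<pi>])

lemma signed_perm_eq_iff: "signed_perm \<pi> \<Longrightarrow> \<pi> a = \<pi> b \<longleftrightarrow> a = b"
proof
  assume *: "signed_perm \<pi>" "\<pi> a = \<pi> b"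
  then have "fst a = fst b" using signed_perm_fst by metis
  then have "a = b \<or> a = inv_letter b" by (cases a; cases b) auto
  then show "a = b" using * signed_perm_inv[OF *(1), of b] by auto
qed simp

lemma signed_perm_comp: "signed_perm \<pi> \<Longrightarrow> signed_perm \<rho> \<Longrightarrow> signed_perm (\<pi> \<circ> \<rho>)"
  unfolding signed_perm_def[of "\<pi> \<circ> \<rho>"] by (simp add: signed_perm_inv signed_perm_fst)

definition perm_of :: "letter \<Rightarrow> letter \<Rightarrow> letter \<Rightarrow> letter" where
  "perm_of x y a = (let b = (case fst a of X1 \<Rightarrow> x | X2 \<Rightarrow> y) in if snd a then b else inv_letter b)"

lemma perm_of_simps [simp]:
  "perm_of x y (X1, True) = x" "perm_of x y (X1, False) = inv_letter x"
  "perm_of x y (X2, True) = y" "perm_of x y (X2, False) = inv_letter y"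
  by (auto simp: perm_of_def)

lemma signed_perm_perm_of: "fst x \<noteq> fst y \<Longrightarrow> signed_perm (perm_of x y)"
proof -
  have "perm_of x y (inv_letter a) = inv_letter (perm_of x y a)" for a
    by (cases a rule: letter_cases) auto
  then show "fst x \<noteq> fst y \<Longrightarrow> signed_perm (perm_of x y)" by (simp add: signed_perm_def)
qed

lemma signed_perm_eq_perm_of:
  "signed_perm \<pi> \<Longrightarrow> \<pi> = perm_of (\<pi> (X1, True)) (\<pi> (X2, True))"
proof
  fix a assume "signed_perm \<pi>"
  then show "\<pi> a = perm_of (\<pi> (X1, True)) (\<pi> (X2, True)) a"
    by (cases a rule: letter_cases) (auto simp: signed_perm_False)
qed

lemma signed_perm_inverse:
  assumes "signed_perm \<pi>"
  shows "\<exists>\<rho>. signed_perm \<rho> \<and> \<rho> \<circ> \<pi> = id \<and> \<pi> \<circ> \<rho> = id"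
proof -
  have fin: "finite (UNIV :: letter set)"
  proof (rule finite_subset)
    show "(UNIV :: letter set) \<subseteq> {(X1, True), (X1, False), (X2, True), (X2, False)}"
      using letter_cases by blast
  qed simp
  have inj: "inj \<pi>" using signed_perm_eq_iff[OF assms] by (simp add: inj_def)
  then have bij: "bij \<pi>" using fin by (simp add: bij_def finite_UNIV_inj_surj)
  let ?\<rho> = "inv_into UNIV \<pi>"
  have 1: "\<pi> (?\<rho> a) = a" "?\<rho> (\<pi> a) = a" for a
    using bij inj by (simp_all add: bij_def surj_f_inv_f)
  have "?\<rho> (inv_letter a) = inv_letter (?\<rho> a)" for a
    by (metis 1 assms signed_perm_inv)
  moreover have "fst (?\<rho> (X1, True)) \<noteq> fst (?\<rho> (X2, True))"
    using signed_perm_fst[OF assms, of "?\<rho> (X1, True)" "?\<rho> (X2, True)"] by (simp add: 1)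
  ultimately show ?thesis using 1 by (intro exI[of _ ?\<rho>]) (auto simp: signed_perm_def)
qed

lemma map_signed_perm: "signed_perm \<pi> \<Longrightarrow> map \<pi> w = subst [\<pi> (X1, True)] [\<pi> (X2, True)] w"
proof (induction w)
  case (Cons a w)
  then show ?case by (cases a rule: letter_cases) (auto simp: signed_perm_False)
qed simp

lemma reduce_map: "signed_perm \<pi> \<Longrightarrow> reduce (map \<pi> w) = map \<pi> (reduce w)"
proof (induction w)
  case (Cons a w)
  have "cons_reduce (\<pi> a) (map \<pi> v) = map \<pi> (cons_reduce a v)" for v
    using Cons.prems by (cases v) (auto simp: signed_perm_inv[symmetric] signed_perm_eq_iff)
  then show ?case using Cons by (simp add: reduce_Cons)
qed simp

lemma cyclic_reduce_map: "signed_perm \<pi> \<Longrightarrow> cyclic_reduce (map \<pi> w) = map \<pi> (cyclic_reduce w)"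
  by (induction w rule: cyclic_reduce.induct)
     (auto simp: last_map signed_perm_inv[symmetric] signed_perm_eq_iff map_butlast[symmetric])

lemma core_map: "signed_perm \<pi> \<Longrightarrow> core (map \<pi> w) = map \<pi> (core w)"
  by (simp add: core_def reduce_map cyclic_reduce_map)

lemma invertible_signed_perm:
  assumes "signed_perm \<pi>" shows "invertible [\<pi> (X1, True)] [\<pi> (X2, True)]"
proof -
  obtain \<rho> where \<rho>: "signed_perm \<rho>" "\<rho> \<circ> \<pi> = id" "\<pi> \<circ> \<rho> = id"
    using signed_perm_inverse[OF assms] by blast
  show ?thesis unfolding invertible_def
    by (intro exI[of _ "[\<rho> (X1, True)]"] exI[of _ "[\<rho> (X2, True)]"])
       (simp add: map_signed_perm[symmetric] assms \<rho>)
qed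

lemma card_signed_perm: "finite {\<pi>. signed_perm \<pi>}" "card {\<pi>. signed_perm \<pi>} \<le> 8"
proof -
  let ?f = "\<lambda>(b, s, t). if b then perm_of (X1, s) (X2, t) else perm_of (X2, s) (X1, t)"
  have sub: "{\<pi>. signed_perm \<pi>} \<subseteq> ?f ` (UNIV :: (bool \<times> bool \<times> bool) set)"
  proof
    fix \<pi> assume "\<pi> \<in> {\<pi>. signed_perm \<pi>}"
    then have \<pi>: "signed_perm \<pi>" by simp
    obtain g s h t where gs: "\<pi> (X1, True) = (g, s)" "\<pi> (X2, True) = (h, t)" by fastforce
    then have "g \<noteq> h" using \<pi> by (simp add: signed_perm_def)
    then have "\<pi> = ?f (g = X1, s, t)"
      using signed_perm_eq_perm_of[OF \<pi>] gs by (cases g; cases h) auto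
    then show "\<pi> \<in> ?f ` UNIV" by blast
  qed
  then show "finite {\<pi>. signed_perm \<pi>}" by (rule finite_subset) simp
  have "card {\<pi>. signed_perm \<pi>} \<le> card (?f ` UNIV)" using sub by (intro card_mono) auto
  also have "\<dots> \<le> card (UNIV :: (bool \<times> bool \<times> bool) set)" by (intro card_image_le) simp
  also have "\<dots> = 8" by (simp add: card_cartesian_product flip: UNIV_Times_UNIV)
  finally show "card {\<pi>. signed_perm \<pi>} \<le> 8" .
qed

section \<open>Factorisation of automorphisms\<close>

definition step :: "bool \<Rightarrow> word \<Rightarrow> word" where
  "step b w = (if b then subst [(X1, True), (X2, True)] [(X2, True)] w
               else subst [(X1, True)] [(X2, True), (X1, True)] w)"

definition step_inv :: "bool \<Rightarrow> word \<Rightarrow> word" where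
  "step_inv b w = (if b then subst [(X1, True), (X2, False)] [(X2, True)] w
               else subst [(X1, True)] [(X2, True), (X1, False)] w)"

definition flip1 :: "letter \<Rightarrow> letter" where "flip1 = perm_of (X1, False) (X2, True)"
definition flip2 :: "letter \<Rightarrow> letter" where "flip2 = perm_of (X1, True) (X2, False)"
definition swap :: "letter \<Rightarrow> letter" where "swap = perm_of (X2, True) (X1, True)"

lemma signed_perm_flips [simp]: "signed_perm flip1" "signed_perm flip2" "signed_perm swap" "signed_perm id"
  by (simp_all add: flip1_def flip2_def swap_def signed_perm_perm_of) (simp add: signed_perm_def)

lemma flip_simps [simp]:
  "flip1 (X1, b) = (X1, \<not> b)" "flip1 (X2, b) = (X2, b)" "flip2 (X1, b) = (X1, b)"
  "flip2 (X2, b) = (X2, \<not> b)" "swap (X1, b) = (X2, b)" "swap (X2, b) = (X1, b)"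
  by (cases b; simp add: flip1_def flip2_def swap_def)+

lemma step_cong: "cyc w = cyc w' \<Longrightarrow> cyc (step b w) = cyc (step b w')"
  unfolding step_def by (cases b) (simp_all only: if_True if_False, (erule cyc_subst_cong)+)

lemma steps_cong: "cyc w = cyc w' \<Longrightarrow> cyc (foldr step P w) = cyc (foldr step P w')"
proof (induction P)
  case (Cons b P)
  then show ?case using step_cong[of "foldr step P w" "foldr step P w'" b] by simp
qed simp

lemma cyc_map_cong: "signed_perm \<pi> \<Longrightarrow> cyc w = cyc w' \<Longrightarrow> cyc (map \<pi> w) = cyc (map \<pi> w')"
  unfolding map_signed_perm by (rule cyc_subst_cong)

lemma step_inv_eq: "step_inv b w = map (if b then flip2 else flip1) (step b (map (if b then flip2 else flip1) w))"
  by (cases b) (simp_all add: step_inv_def step_def map_signed_perm subst_subst)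

lemma step_step_inv: "cyc (step b (step_inv b w)) = cyc w"
proof (rule cyc_cong)
  show "reduce (step b (step_inv b w)) = reduce w"
    using reduce_subst_subst_eqI[of "[(X1, True), (X2, True)]" "[(X2, True)]" "[(X1, True), (X2, False)]" "[(X2, True)]" w]
      reduce_subst_subst_eqI[of "[(X1, True)]" "[(X2, True), (X1, True)]" "[(X1, True)]" "[(X2, True), (X1, False)]" w]
    by (cases b) (simp_all add: step_inv_def step_def reduce_def)
qed

text \<open>The three bases of a Farey triangle: both composites pass from one edge to another
  edge of the same triangle, which takes a single step.\<close>

lemma step_step_inv_other:
  "cyc (step True (step_inv False w)) = cyc (step False (map (perm_of (X2, True) (X1, False)) w))"
  "cyc (step False (step_inv True w)) = cyc (step True (map (perm_of (X2, False) (X1, True)) w))"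
proof -
  show "cyc (step True (step_inv False w)) = cyc (step False (map (perm_of (X2, True) (X1, False)) w))"
    by (simp add: step_inv_def step_def map_signed_perm signed_perm_perm_of subst_subst)
       (rule cyc_subst_conj[of "[(X1, False)]"]; simp add: reduce_def)
  show "cyc (step False (step_inv True w)) = cyc (step True (map (perm_of (X2, False) (X1, True)) w))"
    by (simp add: step_inv_def step_def map_signed_perm signed_perm_perm_of subst_subst)
       (rule cyc_subst_conj[of "[(X2, False)]"]; simp add: reduce_def)
qed

text \<open>The transvection comes out positive exactly when \<open>\<pi>\<close> gives both
  generators the same sign. The comparison is on cyclic words because, when x1 goes to an inverse
  letter, the two factors appear in the opposite order and a conjugation exchanges them.\<close>

lemma map_step:
  assumes "signed_perm \<pi>"
  shows "\<exists>b. (\<forall>w. cyc (map \<pi> (step True w)) = cyc (step b (map \<pi> w))) \<or>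
             (\<forall>w. cyc (map \<pi> (step True w)) = cyc (step_inv b (map \<pi> w)))"
proof -
  obtain g s h t where gs: "\<pi> (X1, True) = (g, s)" "\<pi> (X2, True) = (h, t)" by fastforce
  then have gh: "g \<noteq> h" using assms by (simp add: signed_perm_def)
  have m: "\<pi> = perm_of (g, s) (h, t)" using signed_perm_eq_perm_of[OF assms] gs by simp
  have "cyc (map \<pi> (step True w)) = cyc ((if s = t then step (g = X1) else step_inv (g = X1)) (map \<pi> w))" for w
  proof -
    let ?x = "if s then [] else [(h, t)]"
    have l: "map \<pi> (step True w) = subst [(g, s), (h, t)] [(h, t)] w"
      using assms gs by (simp add: map_signed_perm step_def subst_subst)
    have r: "(if s = t then step (g = X1) else step_inv (g = X1)) (map \<pi> w)
        = subst (if s then [(g, True), (h, t)] else [(h, t), (g, False)]) [(h, t)] w"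
      using assms gs gh by (cases g; cases h; cases s; cases t) 
        (simp_all add: map_signed_perm step_def step_inv_def subst_subst)
    show ?thesis unfolding l r by (rule cyc_subst_conj[of ?x]) simp_all
  qed
  then show ?thesis by (cases "s = t") auto
qed

definition factorises :: "word \<Rightarrow> word \<Rightarrow> bool" where
  "factorises U V \<longleftrightarrow> (\<exists>\<pi> P \<rho>. signed_perm \<pi> \<and> signed_perm \<rho> \<and>
     (\<forall>w. cyc (subst U V w) = cyc (map \<pi> (foldr step P (map \<rho> w)))))"

lemma factorises_permute:
  assumes "factorises U' V'" "signed_perm \<sigma>" "\<And>w. subst U V w = subst U' V' (map \<sigma> w)"
  shows "factorises U V"
proof -
  obtain \<pi> P \<rho> where "signed_perm \<pi>" "signed_perm \<rho>"
    "\<And>w. cyc (subst U' V' w) = cyc (map \<pi> (foldr step P (map \<rho> w)))"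
    using assms(1) by (auto simp: factorises_def)
  then show ?thesis unfolding factorises_def
    by (intro exI[of _ \<pi>] exI[of _ P] exI[of _ "\<rho> \<circ> \<sigma>"]) (auto simp: assms signed_perm_comp)
qed

text \<open>The step is first moved past \<open>\<rho>\<close>. A positive step prolongs the path.
  An inverse step undoes the last entry of \<open>P\<close> (the one that acts first), or turns
  inside a Farey triangle by \<open>step_step_inv_other\<close>, or, if \<open>P\<close> is empty,
  becomes positive after a sign flip on both sides.\<close>

lemma factorises_step:
  assumes "factorises U' V'" "\<And>w. cyc (subst U V w) = cyc (subst U' V' (step True w))"
  shows "factorises U V"
proof -
  obtain \<pi> P \<rho> where *: "signed_perm \<pi>" "signed_perm \<rho>"
    "\<And>w. cyc (subst U' V' w) = cyc (map \<pi> (foldr step P (map \<rho> w)))"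
    using assms(1) by (auto simp: factorises_def)
  have push: "cyc (map \<pi> (foldr step P v)) = cyc (map \<pi> (foldr step P v'))" if "cyc v = cyc v'" for v v' P
    by (rule cyc_map_cong[OF *(1) steps_cong[OF that]])
  obtain b where b: "(\<forall>w. cyc (map \<rho> (step True w)) = cyc (step b (map \<rho> w))) \<or>
             (\<forall>w. cyc (map \<rho> (step True w)) = cyc (step_inv b (map \<rho> w)))"
    using map_step[OF *(2)] by blast
  then show ?thesis
  proof
    assume "\<forall>w. cyc (map \<rho> (step True w)) = cyc (step b (map \<rho> w))"
    then have "cyc (subst U V w) = cyc (map \<pi> (foldr step (P @ [b]) (map \<rho> w)))" for w
      using push[of "map \<rho> (step True w)" "step b (map \<rho> w)"] by (simp add: assms(2) *(3))
    then show ?thesis unfolding factorises_def using * by blast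
  next
    assume "\<forall>w. cyc (map \<rho> (step True w)) = cyc (step_inv b (map \<rho> w))"
    then have e: "cyc (subst U V w) = cyc (map \<pi> (foldr step P (step_inv b (map \<rho> w))))" for w
      using push[of "map \<rho> (step True w)" "step_inv b (map \<rho> w)"] by (simp add: assms(2) *(3))
    show ?thesis
    proof (cases P rule: rev_cases)
      case Nil
      let ?f = "if b then flip2 else flip1"
      have "cyc (subst U V w) = cyc (map (\<pi> \<circ> ?f) (foldr step [b] (map (?f \<circ> \<rho>) w)))" for w
        by (simp add: e Nil step_inv_eq)
      moreover have "signed_perm (\<pi> \<circ> ?f)" "signed_perm (?f \<circ> \<rho>)"
        using * by (auto intro: signed_perm_comp)
      ultimately show ?thesis unfolding factorises_def by blast
    next
      case (snoc Q c)
      show ?thesis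
      proof (cases "c = b")
        case True
        then have "cyc (subst U V w) = cyc (map \<pi> (foldr step Q (map \<rho> w)))" for w
          using push[OF step_step_inv, of Q b "map \<rho> w"] by (simp add: e snoc)
        then show ?thesis unfolding factorises_def using * by blast
      next
        case False
        define \<sigma> where "\<sigma> = (if b then perm_of (X2, False) (X1, True) else perm_of (X2, True) (X1, False))"
        have \<sigma>: "signed_perm \<sigma>" by (simp add: \<sigma>_def signed_perm_perm_of)
        have "cyc (step c (step_inv b v)) = cyc (step b (map \<sigma> v))" for v
          using False step_step_inv_other by (cases b) (auto simp: \<sigma>_def)
        then have "cyc (subst U V w) = cyc (map \<pi> (foldr step (Q @ [b]) (map (\<sigma> \<circ> \<rho>) w)))" for w
          using push[of "step c (step_inv b (map \<rho> w))" "step b (map \<sigma> (map \<rho> w))" Q] by (simp add: e snoc)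
        moreover have "signed_perm (\<sigma> \<circ> \<rho>)" using \<sigma> * by (intro signed_perm_comp)
        ultimately show ?thesis unfolding factorises_def using * by blast
      qed
    qed
  qed
qed

lemma invertible_factorises:
  assumes "invertible U V"
  shows "factorises U V"
proof -
  have "factorises (reduce U) (reduce V)"
  proof (rule nielsen_induct)
    show "invertible (reduce U) (reduce V)" using invertible_cong[OF assms] by simp
    fix U V :: word
    assume "factorises V U"
    then show "factorises U V"
      by (rule factorises_permute[of _ _ swap]) (simp_all add: map_signed_perm subst_subst)
  next
    fix U V :: word
    assume "factorises (winv U) V"
    then show "factorises U V"
      by (rule factorises_permute[of _ _ flip1]) (simp_all add: map_signed_perm subst_subst)
  next
    fix U V :: word
    assume *: "factorises (reduce (U @ V)) V"
    \<comment> \<open>\<open>step True\<close> right-multiplies by the second word, so it leads from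
      (U V, V^-1) to (U, V^-1); a sign flip then restores V.\<close>
    have "factorises U (winv V)"
    proof (rule factorises_step)
      show "factorises (reduce (U @ V)) (winv V)"
        by (rule factorises_permute[OF *, of flip2]) (simp_all add: map_signed_perm subst_subst)
      fix w
      have "reduce (reduce (U @ V) @ winv V) = reduce U"
        using reduce_cong[of U U "V @ winv V" "[]"] by (simp add: reduce_append_left)
      then show "cyc (subst U (winv V) w) = cyc (subst (reduce (U @ V)) (winv V) (step True w))"
        unfolding step_def by (simp add: subst_subst) (intro cyc_cong reduce_subst_cong_images, simp_all)
    qed
    then show "factorises U V"
      by (rule factorises_permute[of _ _ flip2]) (simp_all add: map_signed_perm subst_subst)
  next
    fix U V g :: word
    assume *: "factorises (reduce (g @ U @ winv g)) (reduce (g @ V @ winv g))"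
    have "cyc (subst U V w) = cyc (subst (reduce (g @ U @ winv g)) (reduce (g @ V @ winv g)) w)" for w
    proof -
      have "cyc (subst (reduce (g @ U @ winv g)) (reduce (g @ V @ winv g)) w)
          = cyc (subst (g @ U @ winv g) (g @ V @ winv g) w)"
        by (intro cyc_cong reduce_subst_cong_images) simp_all
      also have "\<dots> = cyc (g @ subst U V w @ winv g)" by (intro cyc_cong reduce_subst_inner)
      finally show ?thesis by (simp only: cyc_conj)
    qed
    then show "factorises U V" using * by (simp add: factorises_def)
  next
    fix a b :: letter assume "fst a \<noteq> fst b"
    then have s: "signed_perm (perm_of a b)" by (rule signed_perm_perm_of)
    then have "cyc (subst [a] [b] w) = cyc (map (perm_of a b) (foldr step [] (map id w)))" for w
      by (simp add: map_signed_perm)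
    then show "factorises [a] [b]" unfolding factorises_def using s signed_perm_flips(4) by blast
  qed simp_all
  moreover have "cyc (subst (reduce U) (reduce V) w) = cyc (subst U V w)" for w
    by (intro cyc_cong reduce_subst_cong_images) simp_all
  ultimately show ?thesis by (simp add: factorises_def)
qed

section \<open>Letter counts and sign changes\<close>

definition letters :: "gen \<Rightarrow> word \<Rightarrow> nat" where
  "letters g w = length (filter (\<lambda>a. fst a = g) w)"

lemma letters_simps [simp]:
  "letters g [] = 0" "letters g (a # w) = (if fst a = g then 1 else 0) + letters g w"
  "letters g (u @ v) = letters g u + letters g v"
  by (auto simp: letters_def)

lemma length_eq_letters: "length w = letters X1 w + letters X2 w"
  by (induction w) (auto intro: gen.exhaust)

definition count_core :: "gen \<Rightarrow> word \<Rightarrow> nat" where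
  "count_core g w = letters g (core w)"

lemma core_cong: "cyc w = cyc w' \<Longrightarrow> \<exists>n. core w = rotate n (core w')"
  using cyclic_class_eqD by (simp add: cyc_core)

lemma count_core_cong: "cyc w = cyc w' \<Longrightarrow> count_core g w = count_core g w'"
  using core_cong[of w w'] by (auto simp: count_core_def letters_def length_filter_rotate)

section \<open>Cyclic neighbours and their signs\<close>

fun adj :: "letter \<Rightarrow> word \<Rightarrow> (letter \<times> letter) list" where
  "adj z [] = []"
| "adj z (a # w) = (a, hd (w @ [z])) # adj z w"

lemma adj_append: "adj z (u @ v) = adj (hd (v @ [z])) u @ adj z v"
  by (induction u) (auto simp: hd_append)

lemma adj_map: "adj (f z) (map f w) = map (map_prod f f) (adj z w)"
  by (induction w) (auto simp: hd_append hd_map)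

definition cadj :: "word \<Rightarrow> (letter \<times> letter) list" where
  "cadj w = adj (hd w) w"

lemma mset_cadj_rotate: "mset (cadj (rotate n w)) = mset (cadj w)"
proof -
  obtain u v where uv: "w = u @ v" "rotate n w = v @ u" using rotate_append_exists by blast
  show ?thesis unfolding uv(2) unfolding uv(1)
    by (cases "u = []"; cases "v = []") (auto simp: cadj_def adj_append hd_append)
qed

lemma cadj_map: "w \<noteq> [] \<Longrightarrow> cadj (map f w) = map (map_prod f f) (cadj w)"
  by (simp add: cadj_def adj_map[symmetric] hd_map)

definition same_sign :: "(letter \<times> letter) list \<Rightarrow> nat" where
  "same_sign ps = length (filter (\<lambda>(a, b). snd a = snd b) ps)"

lemma same_sign_simps [simp]:
  "same_sign [] = 0" "same_sign (p # ps) = (if snd (fst p) = snd (snd p) then 1 else 0) + same_sign ps"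
  "same_sign (ps @ qs) = same_sign ps + same_sign qs"
  by (auto simp: same_sign_def)

text \<open>The number of letters \<open>x\<^sub>2\<^sup>\<plusminus>\<^sup>1\<close> after \<open>x\<^sub>1 \<mapsto> x\<^sub>1x\<^sub>2\<close>, and of letters \<open>x\<^sub>1\<^sup>\<plusminus>\<^sup>1\<close> after
  \<open>x\<^sub>2 \<mapsto> x\<^sub>2x\<^sub>1\<close>. That the two agree is visible in this form, which is symmetric in the
  generators.\<close>

definition persistence :: "word \<Rightarrow> nat" where
  "persistence w = same_sign (cadj (core w))"

lemma same_sign_mset: "mset ps = mset qs \<Longrightarrow> same_sign ps = same_sign qs"
  unfolding same_sign_def by (metis mset_filter size_mset)

lemma persistence_cong: "cyc w = cyc w' \<Longrightarrow> persistence w = persistence w'"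
  using core_cong[of w w'] mset_cadj_rotate same_sign_mset unfolding persistence_def by metis

lemma persistence_map:
  assumes "signed_perm \<pi>" "\<And>a b. snd (\<pi> a) = snd (\<pi> b) \<longleftrightarrow> snd a = snd b"
  shows "persistence (map \<pi> w) = persistence w"
proof (cases "core w = []")
  case False
  have "same_sign (map (map_prod \<pi> \<pi>) ps) = same_sign ps" for ps
    by (induction ps) (auto simp: assms(2))
  then show ?thesis using assms(1) False by (simp add: persistence_def core_map cadj_map)
qed (simp add: persistence_def core_map assms)

lemma count_core_map:
  assumes "signed_perm \<pi>"
  shows "count_core (fst (\<pi> (g, True))) (map \<pi> w) = count_core g w"
proof -
  have "fst (\<pi> a) = fst (\<pi> (g, True)) \<longleftrightarrow> fst a = g" for a
    using signed_perm_fst[OF assms, of a "(g, True)"] by simp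
  then show ?thesis by (simp add: count_core_def core_map assms letters_def filter_map o_def)
qed

section \<open>Syllables\<close>

definition xpow :: "int \<Rightarrow> word" where
  "xpow m = replicate (nat \<bar>m\<bar>) (X2, 0 < m)"

lemma xpow_0 [simp]: "xpow 0 = []" and xpow_1 [simp]: "xpow 1 = [(X2, True)]"
  by (simp_all add: xpow_def)

lemma winv_xpow [simp]: "winv (xpow m) = xpow (- m)"
  by (cases "m = 0") (auto simp: xpow_def winv_def)

lemma reduced_xpow [simp]: "reduced (xpow m)"
  by (auto simp: xpow_def reduced_def successively_conv_nth)

lemma letters_xpow [simp]: "letters X1 (xpow m) = 0" "letters X2 (xpow m) = nat \<bar>m\<bar>"
  by (auto simp: xpow_def letters_def)

lemma xpow_Suc: "m \<ge> 0 \<Longrightarrow> xpow (m + 1) = (X2, True) # xpow m"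
  by (cases "m = 0") (auto simp: xpow_def nat_add_distrib)

lemma xpow_pred: "m \<le> 0 \<Longrightarrow> xpow (m - 1) = (X2, False) # xpow m"
proof -
  assume "m \<le> 0"
  then have "nat \<bar>m - 1\<bar> = Suc (nat \<bar>m\<bar>)" by simp
  then show ?thesis using \<open>m \<le> 0\<close> by (simp add: xpow_def)
qed

lemma reduce_xpow_Cons:
  "reduce ((X2, True) # xpow m) = xpow (m + 1)" "reduce ((X2, False) # xpow m) = xpow (m - 1)"
proof -
  have r: "reduce (xpow m) = xpow m" for m by (simp add: reduce_reduced)
  show "reduce ((X2, True) # xpow m) = xpow (m + 1)"
  proof (cases "m \<ge> 0")
    case True then show ?thesis using xpow_Suc[of m] r[of "m + 1"] by simp
  next
    case False
    then have "xpow m = (X2, False) # xpow (m + 1)" using xpow_pred[of "m + 1"] by simp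
    then show ?thesis using reduce_cancel(1)[of "[(X2, False)]" "xpow (m + 1)"] r by simp
  qed
  show "reduce ((X2, False) # xpow m) = xpow (m - 1)"
  proof (cases "m \<le> 0")
    case True then show ?thesis using xpow_pred[of m] r[of "m - 1"] by simp
  next
    case False
    then have "xpow m = (X2, True) # xpow (m - 1)" using xpow_Suc[of "m - 1"] by simp
    then show ?thesis using reduce_cancel(1)[of "[(X2, True)]" "xpow (m - 1)"] r by simp
  qed
qed

lemma reduce_xpow_xpow: "reduce (xpow a @ xpow b) = xpow (a + b)"
proof (induction a rule: int_induct[of _ 0])
  case base then show ?case by (simp add: reduce_reduced)
next
  case (step1 i)
  have "reduce (xpow (i + 1) @ xpow b) = reduce ([(X2, True)] @ xpow i @ xpow b)"
    using step1 by (simp add: xpow_Suc)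
  also have "\<dots> = reduce ([(X2, True)] @ xpow (i + b))"
    using step1 by (intro reduce_cong) (auto simp: reduce_reduced)
  finally show ?case using reduce_xpow_Cons(1)[of "i + b"] by (simp add: algebra_simps)
next
  case (step2 i)
  have "reduce (xpow (i - 1) @ xpow b) = reduce ([(X2, False)] @ xpow i @ xpow b)"
    using step2 by (simp add: xpow_pred)
  also have "\<dots> = reduce ([(X2, False)] @ xpow (i + b))"
    using step2 by (intro reduce_cong) (auto simp: reduce_reduced)
  finally show ?case using reduce_xpow_Cons(2)[of "i + b"] by (simp add: algebra_simps)
qed

type_synonym syllables = "(bool \<times> int) list"

definition build :: "syllables \<Rightarrow> word" where
  "build sl = concat (map (\<lambda>(s, m). (X1, s) # xpow m) sl)"

lemma build_simps [simp]:
  "build [] = []" "build ((s, m) # sl) = (X1, s) # xpow m @ build sl"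
  "build (sl @ sl') = build sl @ build sl'"
  by (auto simp: build_def)

text \<open>Throughout, \<open>z\<close> is the sign of the letter of x1 after the last syllable;
  for a cyclic word it is the sign of the first syllable.\<close>

definition nxt :: "bool \<Rightarrow> syllables \<Rightarrow> bool" where
  "nxt z sl = (case sl of [] \<Rightarrow> z | p # _ \<Rightarrow> fst p)"

lemma nxt_simps [simp]: "nxt z [] = z" "nxt z ((s, m) # sl) = s"
  by (auto simp: nxt_def)

definition eps :: "bool \<Rightarrow> bool \<Rightarrow> int" where
  "eps s t = (if s = t then if s then 1 else - 1 else 0)"

text \<open>The data of the syllable \<open>x\<^sub>1\<^sup>s x\<^sub>2\<^sup>m\<close> that is followed by \<open>x\<^sub>1\<^sup>t\<close> are \<open>m\<close> and
  the amount \<open>eps s t\<close> by which \<open>x\<^sub>1 \<mapsto> x\<^sub>1x\<^sub>2\<close> changes \<open>m\<close>.\<close>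

fun data :: "bool \<Rightarrow> syllables \<Rightarrow> (int \<times> int) list" where
  "data z [] = []"
| "data z ((s, m) # sl) = (m, eps s (nxt z sl)) # data z sl"

fun valid :: "bool \<Rightarrow> syllables \<Rightarrow> bool" where
  "valid z [] = True"
| "valid z ((s, m) # sl) = ((m = 0 \<longrightarrow> s = nxt z sl) \<and> valid z sl)"

fun twist :: "int \<Rightarrow> bool \<Rightarrow> syllables \<Rightarrow> syllables" where
  "twist k z [] = []"
| "twist k z ((s, m) # sl) = (s, m + k * eps s (nxt z sl)) # twist k z sl"

lemma nxt_twist [simp]: "nxt z (twist k z' sl) = nxt z sl"
  by (cases sl) auto

lemma twist_Nil [simp]: "twist k z sl = [] \<longleftrightarrow> sl = []"
  by (cases sl) auto

lemma fst_hd_twist [simp]: "fst (hd (twist k z sl)) = fst (hd sl)"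
  by (cases sl) auto

lemma length_twist [simp]: "length (twist k z sl) = length sl"
  by (induction k z sl rule: twist.induct) auto

lemma valid_twist [simp]: "valid z (twist k z sl) = valid z sl"
  by (induction k z sl rule: twist.induct) (auto simp: eps_def)

lemma length_data [simp]: "length (data z sl) = length sl"
  by (induction z sl rule: data.induct) auto

definition weight :: "(int \<times> int) list \<Rightarrow> int \<Rightarrow> int" where
  "weight D k = (\<Sum>(m, e)\<leftarrow>D. \<bar>m + k * e\<bar>)"

lemma weight_simps [simp]: "weight [] k = 0" "weight ((m, e) # D) k = \<bar>m + k * e\<bar> + weight D k"
  by (auto simp: weight_def)

lemma letters_build: "letters X1 (build sl) = length sl"
  by (induction sl) auto

lemma letters_build_twist: "int (letters X2 (build (twist k z sl))) = weight (data z sl) k"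
  by (induction k z sl rule: twist.induct) auto

lemma build_Nil [simp]: "build sl = [] \<longleftrightarrow> sl = []"
  by (cases sl) auto

lemma hd_build: "hd (build sl @ [(X1, z)]) = (X1, nxt z sl)"
  by (cases sl) auto

lemma hd_build': "sl \<noteq> [] \<Longrightarrow> hd (build sl) = (X1, fst (hd sl))"
  by (cases sl) auto

lemma reduced_build: "reduced (build sl @ [(X1, z)]) \<longleftrightarrow> valid z sl"
proof (induction z sl rule: valid.induct)
  case (2 z s m sl)
  define R where "R = build sl @ [(X1, z)]"
  have R: "R \<noteq> []" "hd R = (X1, nxt z sl)" by (simp_all add: R_def hd_build)
  have "reduced ((X1, s) # xpow m @ R) \<longleftrightarrow> (m = 0 \<longrightarrow> s = nxt z sl) \<and> reduced R"
  proof (cases "m = 0")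
    case False
    then have "xpow m \<noteq> []" "fst (last (xpow m)) = X2" "fst (hd (xpow m)) = X2" by (auto simp: xpow_def)
    then show ?thesis using R False
      by (auto simp: reduced_Cons reduced_append hd_append inv_letter_def)
  qed (use R in \<open>auto simp: reduced_Cons\<close>)
  then show ?case using 2 by (simp add: R_def)
qed simp

lemma cyclically_reduced_build:
  assumes "sl \<noteq> []" "valid (fst (hd sl)) sl"
  shows "cyclically_reduced (build sl)"
proof -
  have "reduced (build sl @ [(X1, fst (hd sl))])" using assms(2) reduced_build by blast
  then show ?thesis using assms(1) hd_build'[OF assms(1)] inv_letter_swap[of "last (build sl)" "hd (build sl)"]
    by (auto simp: reduced_append cyclically_reduced_def)
qed

lemma reduced_build_exists:
  assumes "reduced w"
  shows "\<exists>m sl. w = xpow m @ build sl"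
  using assms
proof (induction w)
  case Nil
  show ?case by (intro exI[of _ 0] exI[of _ "[]"]) simp
next
  case (Cons a w)
  then obtain m sl where w: "w = xpow m @ build sl" by (auto simp: reduced_Cons)
  show ?case
  proof (cases "fst a")
    case X1
    then have "a # w = xpow 0 @ build ((snd a, m) # sl)" by (cases a) (simp add: w)
    then show ?thesis by blast
  next
    case X2
    then obtain b where a: "a = (X2, b)" by (cases a) auto
    have "b = (m > 0)" if "m \<noteq> 0"
      using Cons.prems that by (auto simp: a w reduced_Cons xpow_def hd_append)
    then have "a # xpow m = xpow (m + (if b then 1 else - 1))"
      using xpow_Suc[of m] xpow_pred[of m] by (cases b; cases "m = 0") (auto simp: a xpow_def)
    then show ?thesis using w by (metis append_Cons)
  qed
qed

lemma syllables_exist: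
  assumes "count_core X1 w > 0"
  shows "\<exists>sl. sl \<noteq> [] \<and> valid (fst (hd sl)) sl \<and> cyc w = cyc (build sl)"
proof -
  obtain a where a: "a \<in> set (core w)" "fst a = X1"
    using assms by (auto simp: count_core_def letters_def filter_empty_conv)
  then obtain u v where uv: "core w = u @ a # v" by (meson split_list)
  \<comment> \<open>The word is rotated to begin with a letter of x1, so that no power of x2
    precedes the first syllable.\<close>
  define c where "c = a # v @ u"
  have c: "c = rotate (length u) (core w)" by (simp add: uv c_def rotate_append)
  then have cr: "cyclically_reduced c" by (simp add: cyclically_reduced_rotate)
  then obtain m sl where sl: "c = xpow m @ build sl"
    using reduced_build_exists[of c] by (auto simp: cyclically_reduced_def)
  have "m = 0"
  proof (rule ccontr)
    assume "m \<noteq> 0"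
    then have "hd c = (X2, 0 < m)" by (simp add: sl xpow_def hd_append)
    then show False using a by (simp add: c_def)
  qed
  then have sl: "c = build sl" using sl by simp
  then have ne: "sl \<noteq> []" by (auto simp: c_def)
  have "reduced (build sl @ [(X1, fst (hd sl))])"
    using cr ne inv_letter_swap[of "last (build sl)" "hd (build sl)"]
    by (auto simp: sl reduced_append cyclically_reduced_def hd_build')
  moreover have "cyc w = cyc (build sl)"
    by (metis c cr cyc_core cyc_cyclically_reduced cyclic_class_rotate sl)
  ultimately show ?thesis using ne reduced_build by blast
qed

lemma core_no_X1:
  assumes "count_core X1 w = 0"
  shows "\<exists>m. core w = xpow m"
proof -
  obtain m sl where "core w = xpow m @ build sl"
    using reduced_build_exists[of "core w"] cyclically_reduced_core[of w] by (auto simp: cyclically_reduced_def)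
  then show ?thesis using assms by (auto simp: count_core_def letters_build)
qed

section \<open>Powers of the transvection x1 -> x1 x2\<close>

definition twisted :: "int \<Rightarrow> word \<Rightarrow> word" where
  "twisted k w = subst ((X1, True) # xpow k) [(X2, True)] w"

lemma step_True_eq: "step True w = twisted 1 w"
  by (simp add: step_def twisted_def)

lemma twisted_cong: "cyc w = cyc w' \<Longrightarrow> cyc (twisted k w) = cyc (twisted k w')"
  unfolding twisted_def by (rule cyc_subst_cong)

lemma subst_xpow: "subst U [(X2, True)] (xpow m) = xpow m"
proof -
  have "hom_letter U [(X2, True)] (X2, b) = [(X2, b)]" for b by (cases b) simp_all
  then have "subst U [(X2, True)] (replicate n (X2, b)) = replicate n (X2, b)" for n b
    by (induction n) simp_all
  then show ?thesis by (simp add: xpow_def)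
qed

lemma twisted_xpow [simp]: "twisted k (xpow m) = xpow m"
  by (simp add: twisted_def subst_xpow)

lemma twisted_twisted: "cyc (twisted j (twisted k w)) = cyc (twisted (j + k) w)"
proof (rule cyc_cong)
  have "reduce ([(X1, True)] @ xpow j @ xpow k) = reduce ([(X1, True)] @ xpow (j + k))"
    by (rule reduce_cong) (simp_all add: reduce_xpow_xpow reduce_reduced)
  then show "reduce (twisted j (twisted k w)) = reduce (twisted (j + k) w)"
    unfolding twisted_def subst_subst subst_xpow
    by (intro reduce_subst_cong_images) (simp_all add: subst_xpow)
qed

lemma twisted_0: "twisted 0 w = w"
  by (simp add: twisted_def)

lemma map_flip2_xpow: "map flip2 (xpow m) = xpow (- m)"
  by (cases "m = 0") (auto simp: xpow_def)

lemma flip2_twisted: "map flip2 (twisted k (map flip2 w)) = twisted (- k) w"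
proof -
  have "subst [(X1, True)] [(X2, False)] (xpow k) = xpow (- k)"
    using map_flip2_xpow[of k] by (simp add: map_signed_perm)
  then show ?thesis by (simp add: twisted_def map_signed_perm subst_subst)
qed

text \<open>The image of x1^s is x1^s between two powers of x2, \<open>h s\<close> on the left and
  \<open>g s\<close> on the right. These merge with the exponents of the neighbouring syllables,
  adding \<open>k * eps s t\<close> to each, and what is left over at the ends is removed by
  conjugation.\<close>

lemma twisted_build:
  assumes "sl \<noteq> []"
  defines "z \<equiv> fst (hd sl)"
  shows "cyc (twisted k (build sl)) = cyc (build (twist k z sl))"
proof -
  define h where "h s = (if s then [] else xpow (- k))" for s
  define g where "g s = (if s then xpow k else [])" for s
  have mid: "reduce (g s @ xpow m @ h t) = reduce (xpow (m + k * eps s t))" for s t m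
  proof -
    have "reduce (xpow m @ xpow (- k)) = xpow (m - k)" using reduce_xpow_xpow[of m "- k"] by simp
    moreover have "reduce (xpow k @ xpow m @ xpow (- k)) = reduce (xpow k @ xpow (m - k))"
      by (rule reduce_cong) (simp_all add: calculation reduce_reduced)
    ultimately show ?thesis
      by (cases s; cases t) (simp_all add: g_def h_def eps_def reduce_xpow_xpow reduce_reduced add.commute)
  qed
  have x: "hom_letter ((X1, True) # xpow k) [(X2, True)] (X1, s) = h s @ [(X1, s)] @ g s" for s
    by (cases s) (simp_all add: h_def g_def)
  have "reduce (twisted k (build sl) @ h z) = reduce (h (nxt z sl) @ build (twist k z sl))" for z sl
  proof (induction sl)
    case (Cons p sl)
    obtain s m where p: "p = (s, m)" by (cases p)
    let ?B = "build (twist k z sl)" and ?T = "twisted k (build sl)"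
    have "reduce (twisted k (build ((s, m) # sl)) @ h z)
        = reduce ((h s @ [(X1, s)] @ g s @ xpow m) @ (?T @ h z))"
      using x[of s] by (simp add: twisted_def subst_xpow)
    also have "\<dots> = reduce ((h s @ [(X1, s)] @ g s @ xpow m) @ (h (nxt z sl) @ ?B))"
      by (rule reduce_cong[OF refl Cons.IH])
    also have "\<dots> = reduce ((h s @ [(X1, s)]) @ (g s @ xpow m @ h (nxt z sl)) @ ?B)" by simp
    also have "\<dots> = reduce ((h s @ [(X1, s)]) @ xpow (m + k * eps s (nxt z sl)) @ ?B)"
      by (intro reduce_cong mid refl)
    finally show ?case by (simp add: p)
  qed (simp add: twisted_def)
  then have "reduce (twisted k (build sl) @ h z) = reduce (h z @ build (twist k z sl))"
    using assms by (cases sl) auto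
  then have "reduce (winv (h z) @ twisted k (build sl) @ h z) = reduce (winv (h z) @ h z @ build (twist k z sl))"
    by (rule reduce_cong[OF refl])
  then have "reduce (winv (h z) @ twisted k (build sl) @ winv (winv (h z))) = reduce (build (twist k z sl))"
    by simp
  then show ?thesis by (metis cyc_conj cyc_cong)
qed

section \<open>Persistence and letter counts in terms of syllables\<close>

lemma same_sign_replicate:
  "same_sign (adj (X1, t) (replicate n (X2, b))) = (if n = 0 then 0 else n - 1 + (if b = t then 1 else 0))"
proof (induction n)
  case (Suc n)
  then show ?case by (cases n) auto
qed simp

text \<open>For nonzero \<open>m\<close> there are |m| - 1 pairs of equal sign inside the power of
  x2 and up to two at its ends: both if s = t is the sign of \<open>m\<close>, none if s = t is the
  opposite sign, exactly one if \<open>s\<close> and \<open>t\<close> differ.\<close>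

lemma same_sign_syllable:
  assumes "m = 0 \<Longrightarrow> s = t"
  shows "int (same_sign (adj (X1, t) ((X1, s) # xpow m))) = \<bar>m + eps s t\<bar>"
proof (cases "m = 0")
  case False
  then have "nat \<bar>m\<bar> \<noteq> 0" by simp
  moreover have "hd (xpow m @ [(X1, t)]) = (X2, 0 < m)" using False by (simp add: xpow_def hd_append)
  ultimately show ?thesis using False
    unfolding xpow_def adj.simps same_sign_simps same_sign_replicate
    by (cases s; cases t) (auto simp: eps_def xpow_def of_nat_diff)
qed (use assms in \<open>auto simp: eps_def\<close>)

lemma same_sign_build:
  "valid z sl \<Longrightarrow> int (same_sign (adj (X1, z) (build sl))) = weight (data z sl) 1"
proof (induction z sl rule: valid.induct)
  case (2 z s m sl)
  have "adj (X1, z) (build ((s, m) # sl)) = adj (X1, nxt z sl) ((X1, s) # xpow m) @ adj (X1, z) (build sl)"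
    using adj_append[of "(X1, z)" "(X1, s) # xpow m" "build sl"] by (simp add: hd_build)
  then show ?case using 2 same_sign_syllable[of m s "nxt z sl"] by simp
qed simp

lemma core_build:
  "sl \<noteq> [] \<Longrightarrow> valid (fst (hd sl)) sl \<Longrightarrow> core (build sl) = build sl"
  by (intro core_cyclically_reduced cyclically_reduced_build)

text \<open>What \<open>data\<close> inherits from reducedness; not to be confused with
  admissibility of cyclic words. A syllable with e = 0 lies between letters x1 and x1^-1, so its
  exponent cannot vanish.\<close>

definition admissible_data :: "(int \<times> int) list \<Rightarrow> bool" where
  "admissible_data D \<longleftrightarrow> (\<forall>(m, e)\<in>set D. e \<in> {-1, 0, 1} \<and> (e = 0 \<longrightarrow> m \<noteq> 0))"

lemma admissible_data_simps [simp]: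
  "admissible_data []"
  "admissible_data ((m, e) # D) \<longleftrightarrow> e \<in> {-1, 0, 1} \<and> (e = 0 \<longrightarrow> m \<noteq> 0) \<and> admissible_data D"
  by (auto simp: admissible_data_def)

lemma admissible_data_data: "valid z sl \<Longrightarrow> admissible_data (data z sl)"
  by (induction z sl rule: valid.induct) (auto simp: eps_def)

lemma syllables_twisted:
  assumes "sl \<noteq> []" "z = fst (hd sl)" "valid z sl" "cyc w = cyc (build sl)"
  shows "count_core X1 (twisted k w) = length sl"
    "int (count_core X2 (twisted k w)) = weight (data z sl) k"
    "cyc (twisted k w) = cyc (build (twist k z sl))"
    "int (persistence w) = weight (data z sl) 1"
proof -
  show e: "cyc (twisted k w) = cyc (build (twist k z sl))"
    using twisted_cong[OF assms(4), of k] twisted_build[OF assms(1), of k] assms(2) by simp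
  have c: "core (build (twist k z sl)) = build (twist k z sl)"
    using assms by (intro core_build) auto
  show "count_core X1 (twisted k w) = length sl"
    "int (count_core X2 (twisted k w)) = weight (data z sl) k"
    unfolding count_core_cong[OF e] by (simp_all add: count_core_def c letters_build letters_build_twist)
  have "hd (build sl) = (X1, z)" using assms hd_build' by simp
  then show "int (persistence w) = weight (data z sl) 1"
    unfolding persistence_cong[OF assms(4)] using assms same_sign_build[of z sl]
    by (simp add: persistence_def core_build cadj_def)
qed

lemma no_X1_twisted:
  assumes "count_core X1 w = 0"
  shows "cyc (twisted k w) = cyc w" "persistence w = count_core X2 w"
proof -
  obtain m where m: "core w = xpow m" using core_no_X1[OF assms] by blast
  have "cyc w = cyc (xpow m)"
    by (metis core_cyclically_reduced cyc_core cyclically_reduced_core m)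
  then show "cyc (twisted k w) = cyc w" using twisted_cong[of w "xpow m" k] by simp
  have "same_sign (adj (X2, b) (replicate n (X2, b))) = n" for n b
  proof (induction n)
    case (Suc n) then show ?case by (cases n) auto
  qed simp
  moreover have "m \<noteq> 0 \<Longrightarrow> hd (xpow m) = (X2, 0 < m)" by (simp add: xpow_def)
  ultimately have "same_sign (cadj (xpow m)) = nat \<bar>m\<bar>"
    by (cases "m = 0") (auto simp: cadj_def, simp add: xpow_def)
  then show "persistence w = count_core X2 w" by (simp add: persistence_def count_core_def m)
qed

lemma twisted_data:
  assumes "count_core X1 w > 0"
  shows "\<exists>D. admissible_data D \<and> length D = count_core X1 w \<and>
    (\<forall>k. int (count_core X2 (twisted k w)) = weight D k) \<and> int (persistence w) = weight D 1"
proof -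
  obtain sl where "sl \<noteq> []" "valid (fst (hd sl)) sl" "cyc w = cyc (build sl)"
    using syllables_exist[OF assms] by blast
  note s = syllables_twisted[OF this(1) refl this(2,3)]
  then show ?thesis
    using admissible_data_data[OF \<open>valid (fst (hd sl)) sl\<close>] s(1)[of 0]
    by (intro exI[of _ "data (fst (hd sl)) sl"]) (auto simp: twisted_0)
qed

lemma count_X1_twisted: "count_core X1 (twisted k w) = count_core X1 w"
proof (cases "count_core X1 w = 0")
  case True
  then show ?thesis using count_core_cong[OF no_X1_twisted(1)[OF True]] by metis
next
  case False
  then obtain sl where "sl \<noteq> []" "valid (fst (hd sl)) sl" "cyc w = cyc (build sl)"
    using syllables_exist by blast
  then show ?thesis using syllables_twisted(1)[of sl _ w] twisted_0[of w] by metis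
qed

lemma count_X2_twisted_1: "count_core X2 (twisted 1 w) = persistence w"
proof (cases "count_core X1 w = 0")
  case True
  then show ?thesis using no_X1_twisted[OF True] count_core_cong by metis
next
  case False
  then obtain D where "\<And>k. int (count_core X2 (twisted k w)) = weight D k" "int (persistence w) = weight D 1"
    using twisted_data by blast
  then show ?thesis by (metis of_nat_eq_iff)
qed

text \<open>Each summand is the absolute value of an affine function of the power.\<close>

lemma weight_convex: "weight D 2 + weight D 0 \<ge> 2 * weight D 1"
proof (induction D)
  case (Cons p D)
  obtain m e where p: "p = (m, e)" by fastforce
  have "\<bar>m + 2 * e\<bar> + \<bar>m\<bar> \<ge> 2 * \<bar>m + e\<bar>" by arith
  then show ?case using Cons by (simp add: p)
qed simp

text \<open>For e = 1 or e = -1 each summand is bounded by the triangle inequality, and for e = 0 by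
  |m| >= 1.\<close>

lemma weight_ge_length: "admissible_data D \<Longrightarrow> weight D 2 + weight D 0 \<ge> 2 * int (length D)"
proof (induction D)
  case (Cons p D)
  obtain m e where p: "p = (m, e)" by fastforce
  have "\<bar>m + 2 * e\<bar> + \<bar>m\<bar> \<ge> 2" using Cons.prems by (auto simp: p)
  then show ?case using Cons by (simp add: p)
qed simp

lemma count_X2_twisted_2:
  "2 * max (count_core X2 (twisted 1 w)) (count_core X1 w) \<le> count_core X2 (twisted 2 w) + count_core X2 w"
proof (cases "count_core X1 w = 0")
  case True
  then show ?thesis using no_X1_twisted(1)[OF True] count_core_cong by (metis max_0R mult_2 order_refl)
next
  case False
  then obtain D where D: "admissible_data D" "length D = count_core X1 w" 
    "\<And>k. int (count_core X2 (twisted k w)) = weight D k"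
    using twisted_data by blast
  show ?thesis using weight_convex[of D] weight_ge_length[OF D(1)] D(2) D(3)[of 0] D(3)[of 1] D(3)[of 2]
    by (simp add: twisted_0)
qed

section \<open>Monotonicity of the length\<close>

text \<open>Neither positive transvection shortens the word: by \<open>step_counts\<close> each
  replaces one of the two counts by the persistence.\<close>

definition balanced :: "word \<Rightarrow> bool" where
  "balanced w \<longleftrightarrow> count_core X1 w \<le> persistence w \<and> count_core X2 w \<le> persistence w"

definition len :: "word \<Rightarrow> nat" where "len w = length (core w)"

lemma len_eq: "len w = count_core X1 w + count_core X2 w"
  by (simp add: len_def count_core_def length_eq_letters)

lemma len_cong: "cyc w = cyc w' \<Longrightarrow> len w = len w'"
  using count_core_cong[of w w'] by (simp add: len_eq)

lemma len_map: "signed_perm \<pi> \<Longrightarrow> len (map \<pi> w) = len w"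
  by (simp add: len_def core_map)

lemma swap_snd: "snd (swap a) = snd (swap b) \<longleftrightarrow> snd a = snd b"
  by (cases a rule: letter_cases; cases b rule: letter_cases) simp_all

lemma swap_counts [simp]:
  "count_core X1 (map swap w) = count_core X2 w" "count_core X2 (map swap w) = count_core X1 w"
  "persistence (map swap w) = persistence w"
  using count_core_map[of swap X2 w] count_core_map[of swap X1 w] persistence_map[of swap w] swap_snd by auto

lemma swap_swap [simp]: "map swap (map swap w) = w" "swap \<circ> swap = id"
proof -
  show "swap \<circ> swap = id"
  proof
    fix a show "(swap \<circ> swap) a = id a" by (cases a rule: letter_cases) simp_all
  qed
  then show "map swap (map swap w) = w" by simp
qed

lemma step_False_eq: "step False w = map swap (step True (map swap w))"
  by (simp add: step_def map_signed_perm subst_subst)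

text \<open>The new persistence is the count of x2 after two twists. By convexity it is at least
  twice the old persistence minus the count of x2, hence at least the old persistence.\<close>

lemma balanced_step_True:
  assumes "balanced w" shows "balanced (step True w)"
proof -
  have "persistence (twisted 1 w) = count_core X2 (twisted 2 w)"
    using count_core_cong[OF twisted_twisted[of 1 1 w]] count_X2_twisted_1[of "twisted 1 w"] by simp
  then show ?thesis using assms count_X2_twisted_2[of w]
    by (simp add: balanced_def step_True_eq count_X1_twisted count_X2_twisted_1)
qed

lemma balanced_step: "balanced w \<Longrightarrow> balanced (step b w)"
  using balanced_step_True[of w] balanced_step_True[of "map swap w"]
  by (cases b) (auto simp: balanced_def step_False_eq simp del: map_map)

lemma step_counts:
  "count_core X1 (step True w) = count_core X1 w" "count_core X2 (step True w) = persistence w"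
  "count_core X2 (step False w) = count_core X2 w" "count_core X1 (step False w) = persistence w"
  by (simp_all add: step_True_eq step_False_eq count_X1_twisted count_X2_twisted_1 del: map_map)

lemma len_step: "balanced w \<Longrightarrow> len w \<le> len (step b w)"
  by (cases b) (simp_all add: len_eq step_counts balanced_def)

lemma balanced_steps: "balanced w \<Longrightarrow> balanced (foldr step P w) \<and> len w \<le> len (foldr step P w)"
proof (induction P)
  case (Cons b P)
  then have "balanced (foldr step P w)" "len w \<le> len (foldr step P w)" by auto
  then show ?case using balanced_step len_step le_trans by (metis comp_apply foldr.simps(2))
qed simp

text \<open>Lengths never drop along the path, so every step keeps the length and, by induction,
  both counts. A \<open>step False\<close> would raise the smaller count to the persistence, which
  is at least the larger count.\<close>

lemma steps_eq_twisted:
  assumes "balanced w" "count_core X1 w < count_core X2 w" "len (foldr step P w) = len w"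
  shows "\<exists>k. cyc (foldr step P w) = cyc (twisted k w)"
  using assms(3)
proof (induction P)
  case Nil
  show ?case by (intro exI[of _ 0]) (simp add: twisted_0)
next
  case (Cons b P)
  define v where "v = foldr step P w"
  have v: "balanced v" "len w \<le> len v" using balanced_steps[OF assms(1)] by (auto simp: v_def)
  have "len v \<le> len (step b v)" using len_step v by blast
  then have lv: "len v = len w" "len (step b v) = len v" using Cons.prems v by (auto simp: v_def)
  then obtain k where k: "cyc v = cyc (twisted k w)" using Cons.IH by (auto simp: v_def)
  have cv: "count_core X1 v = count_core X1 w" "count_core X2 v = count_core X2 w"
    using lv(1) count_core_cong[OF k] by (auto simp: count_X1_twisted len_eq)
  have "b"
  proof (rule ccontr)
    assume "\<not> b"
    then have "persistence v = count_core X1 v" using lv(2) by (simp add: len_eq step_counts)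
    then show False using v(1) cv assms(2) by (simp add: balanced_def)
  qed
  then have "cyc (foldr step (b # P) w) = cyc (twisted 1 v)" by (simp add: v_def step_True_eq)
  also have "\<dots> = cyc (twisted (1 + k) w)" using twisted_cong[OF k, of 1] twisted_twisted by simp
  finally show ?case by blast
qed

lemma steps_swap: "foldr step P (map swap w) = map swap (foldr step (map Not P) w)"
proof (induction P)
  case (Cons b P)
  have "step b (map swap v) = map swap (step (\<not> b) v)" for v
    by (cases b) (simp_all add: step_False_eq del: map_map)
  then show ?case using Cons by simp
qed simp

lemma twisted_map:
  assumes "signed_perm \<rho>" "fst (\<rho> (X1, True)) = X1"
  shows "\<exists>k'. \<forall>w. cyc (twisted k (map \<rho> w)) = cyc (map \<rho> (twisted k' w))"
proof -
  obtain s t where st: "\<rho> (X1, True) = (X1, s)" "\<rho> (X2, True) = (X2, t)"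
    using assms by (metis (full_types) gen.exhaust prod.collapse signed_perm_def)
  have xp: "map \<rho> (xpow m) = xpow (if t then m else - m)" for m
    using st(2) signed_perm_False[OF assms(1), of X2] by (cases "m = 0"; cases "0 < m") (auto simp: xpow_def)
  \<comment> \<open>Different signs of the images of x1 and x2 reverse the direction of the
    twist.\<close>
  define k' where "k' = (if s = t then k else - k)"
  have r: "map \<rho> (twisted k' w) = subst ((X1, s) # xpow (if s then k else - k)) [(X2, t)] w" for w
    using xp[of k'] st by (cases s; cases t) (simp_all add: map_signed_perm[OF assms(1)] twisted_def subst_subst k'_def)
  have l: "twisted k (map \<rho> w) = subst (if s then (X1, True) # xpow k else xpow (- k) @ [(X1, False)]) [(X2, t)] w" for w
    using st by (cases s; cases t) (simp_all add: map_signed_perm[OF assms(1)] twisted_def subst_subst)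
  have tt: "[(X2, t)] = xpow (if t then 1 else - 1)" by (simp add: xpow_def)
  have "cyc (map \<rho> (twisted k' w)) = cyc (twisted k (map \<rho> w))" for w
    unfolding l r
    by (rule cyc_subst_conj[of "if s then [] else xpow (- k)"])
       (simp_all add: tt reduce_xpow_xpow del: reduce_xpow_Cons)
  then show ?thesis by metis
qed

text \<open>In the factorisation of the automorphism the path starts at the balanced word
  \<open>map \<rho> w\<close> and never shortens it; at equal length the path is a power of the
  twist, which passes through \<open>\<rho>\<close>.\<close>

lemma balanced_orbit:
  assumes bal: "\<And>\<pi>. signed_perm \<pi> \<Longrightarrow> balanced (map \<pi> w)" and "invertible U V"
  shows "len w \<le> len (subst U V w)"
    "count_core X1 w < count_core X2 w \<Longrightarrow> len (subst U V w) = len w \<Longrightarrow>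
       \<exists>\<sigma> k. signed_perm \<sigma> \<and> cyc (subst U V w) = cyc (map \<sigma> (twisted k w))"
proof -
  obtain \<pi> P \<rho> where *: "signed_perm \<pi>" "signed_perm \<rho>" "fst (\<rho> (X1, True)) = X1"
    "\<And>w. cyc (subst U V w) = cyc (map \<pi> (foldr step P (map \<rho> w)))"
  proof -
    obtain \<pi> P \<rho> where *: "signed_perm \<pi>" "signed_perm \<rho>"
      "\<And>w. cyc (subst U V w) = cyc (map \<pi> (foldr step P (map \<rho> w)))"
      using invertible_factorises[OF assms(2)] by (auto simp: factorises_def)
    show thesis
    proof (cases "fst (\<rho> (X1, True))")
      case X1 then show ?thesis using * that by blast
    next
      case X2
      \<comment> \<open>If \<open>\<rho>\<close> exchanges the generators, a swap is moved through
        the path, exchanging the two kinds of steps.\<close>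
      have "map \<rho> w = map swap (map (swap \<circ> \<rho>) w)" for w by (metis swap_swap(1) map_map)
      then have "cyc (subst U V w) = cyc (map (\<pi> \<circ> swap) (foldr step (map Not P) (map (swap \<circ> \<rho>) w)))" for w
        using *(3)[of w] steps_swap[of P "map (swap \<circ> \<rho>) w"] by (metis map_map)
      moreover have "fst ((swap \<circ> \<rho>) (X1, True)) = X1" using X2 by (cases "\<rho> (X1, True)") simp
      ultimately show ?thesis using that[of "\<pi> \<circ> swap" "swap \<circ> \<rho>"] * signed_perm_comp by simp
    qed
  qed
  let ?w = "map \<rho> w"
  have b: "balanced ?w" using bal *(2) by blast
  have l: "len (subst U V w) = len (foldr step P ?w)"
    using len_cong[OF *(4)[of w]] len_map[OF *(1)] by simp
  have l0: "len ?w = len w" using len_map[OF *(2)] .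
  show "len w \<le> len (subst U V w)" using balanced_steps[OF b] l l0 by simp
  assume lt: "count_core X1 w < count_core X2 w" and eq: "len (subst U V w) = len w"
  have "fst (\<rho> (X2, True)) = X2" using *(2,3) by (metis gen.exhaust signed_perm_def)
  then have "count_core X1 ?w < count_core X2 ?w"
    using lt count_core_map[OF *(2), of X1 w] count_core_map[OF *(2), of X2 w] *(3) by simp
  then obtain k where k: "cyc (foldr step P ?w) = cyc (twisted k ?w)"
    using steps_eq_twisted[OF b] eq l l0 by metis
  obtain k' where k': "cyc (twisted k ?w) = cyc (map \<rho> (twisted k' w))"
    using twisted_map[OF *(2,3)] by blast
  have "cyc (subst U V w) = cyc (map (\<pi> \<circ> \<rho>) (twisted k' w))"
    using *(4)[of w] cyc_map_cong[OF *(1), of "foldr step P ?w" "map \<rho> (twisted k' w)"] k k' by simp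
  then show "\<exists>\<sigma> k. signed_perm \<sigma> \<and> cyc (subst U V w) = cyc (map \<sigma> (twisted k w))"
    using signed_perm_comp[OF *(1,2)] by blast
qed

section \<open>Counting\<close>

definition shortest :: "word \<Rightarrow> bool" where
  "shortest w \<longleftrightarrow> (\<forall>U V. invertible U V \<longrightarrow> len w \<le> len (subst U V w))"

definition shortest_images :: "word \<Rightarrow> cyclic_word set" where
  "shortest_images w = {cyc (subst U V w) | U V. invertible U V \<and> len (subst U V w) = len w}"

lemma cyclic_length_cyc: "cyclic_length (cyc w) = len w"
  by (simp add: cyc_core cyclic_length_cyclic_class len_def)

lemma occurrences_cyc: "occurrences g (cyc w) = count_core g w"
  by (simp add: cyc_core occurrences_cyclic_class count_core_def letters_def)

lemma minimal_in_orbit_iff: "minimal_in_orbit (cyc w) \<longleftrightarrow> shortest w"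
  and N_cyc: "N (cyc w) = card (shortest_images w)"
proof -
  have O: "Orb (cyc w) = {cyc (subst U V w) | U V. invertible U V}"
    unfolding cyc_core[of w] using Orb_cyclic_class[OF cyclically_reduced_core[of w]]
    by (simp flip: cyc_subst_core)
  show "minimal_in_orbit (cyc w) \<longleftrightarrow> shortest w"
    unfolding minimal_in_orbit_def O shortest_def cyclic_length_cyc
    by (auto simp: cyclic_length_cyc) (metis cyclic_length_cyc)
  have "{v \<in> Orb (cyc w). cyclic_length v = cyclic_length (cyc w)} = shortest_images w"
    unfolding O shortest_images_def by (auto simp: cyclic_length_cyc) blast
  then show "N (cyc w) = card (shortest_images w)" by (simp add: N_def)
qed

lemma cyclic_words_cyc: "u \<in> cyclic_words \<Longrightarrow> \<exists>w. u = cyc w"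
  by (auto simp: cyclic_words_def) (metis cyc_cyclically_reduced)

lemma cyc_cyclic_words: "cyc w \<in> cyclic_words"
  by (auto simp: cyclic_words_def cyc_core)

text \<open>A positive transvection after \<open>\<pi>\<close> is again an automorphism, so it
  cannot shorten \<open>w\<close>; composing \<open>\<pi>\<close> with \<open>swap\<close> gives the
  bound for the other generator.\<close>

lemma shortest_balanced:
  assumes "shortest w" "signed_perm \<pi>"
  shows "balanced (map \<pi> w)"
proof -
  have *: "count_core X2 (map \<pi> w) \<le> persistence (map \<pi> w)" if "signed_perm \<pi>" for \<pi>
  proof -
    let ?t = "subst [(X1, True), (X2, True)] [(X2, True)]"
    have "step True (map \<pi> w) = subst (?t [\<pi> (X1, True)]) (?t [\<pi> (X2, True)]) w"
      by (simp only: step_def map_signed_perm[OF that] subst_subst if_True)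
    moreover have "invertible (?t [\<pi> (X1, True)]) (?t [\<pi> (X2, True)])"
      by (intro invertible_compose invertible_transvection invertible_signed_perm that)
    ultimately have "len w \<le> len (step True (map \<pi> w))" using assms(1) unfolding shortest_def by metis
    then have "len (map \<pi> w) \<le> len (step True (map \<pi> w))" using len_map[OF that] by simp
    then show ?thesis by (simp add: len_eq step_counts)
  qed
  have "count_core X1 (map \<pi> w) \<le> persistence (map \<pi> w)"
    using *[OF signed_perm_comp[OF signed_perm_flips(3) assms(2)]] swap_counts[of "map \<pi> w"] by simp
  then show ?thesis using *[OF assms(2)] by (simp add: balanced_def)
qed

lemma invertible_twisted: "invertible ((X1, True) # xpow k) [(X2, True)]"
proof (rule invertibleI[of _ _ "(X1, True) # xpow (- k)" "[(X2, True)]"])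
  have "reduce ([(X1, True)] @ xpow k @ xpow (- k)) = [(X1, True)]" for k
    using reduce_cong[of "[(X1, True)]" "[(X1, True)]" "xpow k @ xpow (- k)" "[]"]
    by (simp add: reduce_xpow_xpow reduce_reduced)
  from this[of k] this[of "- k"]
  show "reduce (subst ((X1, True) # xpow k) [(X2, True)] ((X1, True) # xpow (- k))) = [(X1, True)]"
    "reduce (subst ((X1, True) # xpow (- k)) [(X2, True)] ((X1, True) # xpow k)) = [(X1, True)]"
    by (simp_all add: subst_xpow)
qed (simp_all add: reduce_reduced)

lemma shortest_images_subset:
  assumes "shortest w" "count_core X1 w < count_core X2 w"
  shows "shortest_images w \<subseteq> {cyc (map \<sigma> (twisted k w)) | \<sigma> k. signed_perm \<sigma> \<and> count_core X2 (twisted k w) = count_core X2 w}"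
proof
  fix v assume "v \<in> shortest_images w"
  then obtain U V where UV: "v = cyc (subst U V w)" "invertible U V" "len (subst U V w) = len w"
    by (auto simp: shortest_images_def)
  obtain \<sigma> k where *: "signed_perm \<sigma>" "cyc (subst U V w) = cyc (map \<sigma> (twisted k w))"
    using balanced_orbit(2)[OF shortest_balanced[OF assms(1)] UV(2) assms(2) UV(3)] by blast
  have "len (twisted k w) = len w" using len_cong[OF *(2)] len_map[OF *(1)] UV(3) by simp
  then have "count_core X2 (twisted k w) = count_core X2 w" by (simp add: len_eq count_X1_twisted)
  then show "v \<in> {cyc (map \<sigma> (twisted k w)) | \<sigma> k. signed_perm \<sigma> \<and> count_core X2 (twisted k w) = count_core X2 w}"
    using UV(1) * by blast
qed

lemma card_le_8_times:
  assumes "A \<subseteq> {cyc (map \<sigma> (f k)) | \<sigma> k. signed_perm \<sigma> \<and> k \<in> K}" "finite K"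
  shows "card A \<le> 8 * card K"
proof -
  let ?g = "\<lambda>(\<sigma>, k). cyc (map \<sigma> (f k))"
  have "A \<subseteq> ?g ` ({\<sigma>. signed_perm \<sigma>} \<times> K)" using assms(1) by auto
  then have "card A \<le> card (?g ` ({\<sigma>. signed_perm \<sigma>} \<times> K))"
    using assms(2) card_signed_perm(1) by (intro card_mono) auto
  also have "\<dots> \<le> card ({\<sigma>. signed_perm \<sigma>} \<times> K)"
    using assms(2) card_signed_perm(1) by (intro card_image_le) auto
  also have "\<dots> \<le> 8 * card K"
    using card_signed_perm(2) by (simp add: card_cartesian_product)
  finally show ?thesis .
qed

section \<open>The integers at which the weight is minimal\<close>

definition moving :: "(int \<times> int) list \<Rightarrow> int" where
  "moving D = (\<Sum>(m, e)\<leftarrow>D. \<bar>e\<bar>)"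

lemma moving_simps [simp]: "moving [] = 0" "moving ((m, e) # D) = \<bar>e\<bar> + moving D"
  by (auto simp: moving_def)

lemma moving_bounds: "admissible_data D \<Longrightarrow> 0 \<le> moving D \<and> moving D \<le> int (length D)"
  by (induction D) auto

text \<open>An absolute value has the parity of its argument, so each syllable changes the weight by
  \<open>e\<close> modulo 2.\<close>

lemma weight_parity: "admissible_data D \<Longrightarrow> even (weight D (k + 1) - weight D k) \<longleftrightarrow> even (moving D)"
proof (induction D)
  case (Cons p D)
  obtain m e where p: "p = (m, e)" by fastforce
  have "even (\<bar>m + (k + 1) * e\<bar> - \<bar>m + k * e\<bar> + e)"
    by (cases "even e"; cases "even m"; cases "even k") (simp_all add: algebra_simps)
  moreover have "weight (p # D) (k + 1) - weight (p # D) k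
      = (\<bar>m + (k + 1) * e\<bar> - \<bar>m + k * e\<bar>) + (weight D (k + 1) - weight D k)" by (simp add: p)
  ultimately show ?case using Cons by (simp add: p) blast
qed simp

text \<open>Convexity in terms of slopes: from \<open>a\<close> to \<open>a + 1\<close> the slope is
  at most that from \<open>a\<close> to \<open>b\<close>.\<close>

lemma weight_chord:
  assumes "a < b"
  shows "(b - a) * weight D (a + 1) \<le> (b - a - 1) * weight D a + weight D b"
proof (induction D)
  case (Cons p D)
  obtain m e where p: "p = (m, e)" by fastforce
  have "(b - a) * \<bar>m + (a + 1) * e\<bar> = \<bar>(b - a) * (m + (a + 1) * e)\<bar>"
    using assms by (simp add: abs_mult)
  also have "(b - a) * (m + (a + 1) * e) = (b - a - 1) * (m + a * e) + (m + b * e)"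
    by (simp add: algebra_simps)
  also have "\<bar>\<dots>\<bar> \<le> (b - a - 1) * \<bar>m + a * e\<bar> + \<bar>m + b * e\<bar>"
    using assms abs_triangle_ineq[of "(b - a - 1) * (m + a * e)" "m + b * e"] by (simp add: abs_mult)
  finally show ?case using Cons by (simp add: p algebra_simps)
qed simp

text \<open>A moving syllable contributes at least b - a by the triangle inequality, any other at
  least 2, its exponent being nonzero.\<close>

lemma weight_pair:
  assumes "a \<le> b" "admissible_data D"
  shows "(b - a) * moving D + 2 * (int (length D) - moving D) \<le> weight D a + weight D b"
  using assms(2)
proof (induction D)
  case (Cons p D)
  obtain m e where p: "p = (m, e)" by fastforce
  have "(b - a) * \<bar>e\<bar> + 2 * (1 - \<bar>e\<bar>) \<le> \<bar>m + a * e\<bar> + \<bar>m + b * e\<bar>"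
    using Cons.prems assms(1) by (auto simp: p)
  then show ?case using Cons by (simp add: p algebra_simps)
qed simp

text \<open>Let d be the distance between the extreme minimisers. \<open>weight_pair\<close> bounds
  it, and if d > 0 the chord inequality makes the successor of the smallest minimiser a minimiser
  too, so \<open>weight_parity\<close> forces \<open>moving D\<close> to be even.\<close>

lemma flat_stretch:
  fixes q :: int
  assumes D: "admissible_data D" and min: "\<And>k. q \<le> weight D k" and mv: "moving D > 0"
  defines "K \<equiv> {k. weight D k = q}"
  shows "finite K"
    "card K \<le> 1 \<or> (\<exists>d\<ge>1. int (card K) \<le> d + 1 \<and> even (moving D) \<and>
       d * moving D + 2 * (int (length D) - moving D) \<le> 2 * q)"
proof -
  have pair: "(b - a) * moving D + 2 * (int (length D) - moving D) \<le> 2 * q" if "a \<in> K" "b \<in> K" "a \<le> b" for a b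
    using weight_pair[OF that(3) D] that(1,2) by (simp add: K_def)
  have bound: "b - a \<le> 2 * q" if "a \<in> K" "b \<in> K" "a \<le> b" for a b
  proof -
    have "b - a \<le> (b - a) * moving D" using that(3) mv by (simp add: mult_le_cancel_left1)
    also have "\<dots> \<le> (b - a) * moving D + 2 * (int (length D) - moving D)"
      using moving_bounds[OF D] by simp
    also have "\<dots> \<le> 2 * q" by (rule pair[OF that])
    finally show ?thesis .
  qed
  show fin: "finite K"
  proof (cases "K = {}")
    case False
    then obtain a where "a \<in> K" by blast
    then have "K \<subseteq> {a - 2 * q..a + 2 * q}" using bound[of a] bound[of _ a] by force
    then show ?thesis using finite_subset by blast
  qed simp
  show "card K \<le> 1 \<or> (\<exists>d\<ge>1. int (card K) \<le> d + 1 \<and> even (moving D) \<and>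
       d * moving D + 2 * (int (length D) - moving D) \<le> 2 * q)"
  proof (cases "K = {}")
    case False
    define a b where "a = Min K" and "b = Max K"
    have ab: "a \<in> K" "b \<in> K" "a \<le> b" "K \<subseteq> {a..b}"
      using fin False by (auto simp: a_def b_def)
    have card: "card K \<le> nat (b - a + 1)"
      using card_mono[OF _ ab(4)] by simp
    show ?thesis
    proof (cases "a = b")
      case True then show ?thesis using card by simp
    next
      case ne: False
      then have lt: "a < b" using ab(3) by simp
      have "(b - a) * weight D (a + 1) \<le> (b - a) * q"
        using weight_chord[OF lt, of D] ab by (simp add: K_def algebra_simps)
      then have "weight D (a + 1) = q" using lt min[of "a + 1"] by simp
      then have "even (moving D)" using weight_parity[OF D, of a] ab(1) by (simp add: K_def)
      moreover have "int (card K) \<le> (b - a) + 1" using card lt by simp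
      ultimately show ?thesis using pair[OF ab(1-3)] lt by (intro disjI2 exI[of _ "b - a"]) auto
    qed
  qed simp
qed

lemma twist_not_moving: "moving (data z sl) = 0 \<Longrightarrow> twist k z sl = sl"
proof (induction k z sl rule: twist.induct)
  case (2 k z s m sl)
  have "moving (data z sl) \<ge> 0" for z sl
    by (induction z sl rule: data.induct) auto
  from this[of z sl] 2 show ?case by auto
qed simp

text \<open>Syllables with e = 0 mark the sign changes around the cycle. Their number is even, so it
  is not 3 - 2 = 1.\<close>

lemma moving_length_3:
  assumes "length sl = 3"
  shows "moving (data (fst (hd sl)) sl) \<noteq> 2"
proof -
  obtain s m t n r l where "sl = [(s, m), (t, n), (r, l)]"
    using assms by (auto simp: numeral_3_eq_3 length_Suc_conv)
  then show ?thesis by (cases s; cases t; cases r) (simp_all add: eps_def)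
qed

lemma two_syllables:
  assumes "length sl = 2" "moving (data (fst (hd sl)) sl) = 2"
  shows "\<exists>s m n. sl = [(s, m), (s, n)]"
proof -
  obtain s m t n where "sl = [(s, m), (t, n)]"
    using assms(1) by (auto simp: numeral_2_eq_2 length_Suc_conv)
  then show ?thesis using assms(2) by (cases s; cases t) (auto simp: eps_def)
qed

text \<open>The exceptional words, for which the twists alone are too many. Minimal twists have
  exponents j and j - q with 0 <= j <= q; inverting x2 and rotating identifies j with q - j, so j <=
  q / 2 suffices.\<close>

lemma card_two_syllables:
  assumes sh: "shortest w" and lt: "count_core X1 w < count_core X2 w"
    and w: "cyc w = cyc (build [(s, m), (s, n)])" and len: "len w \<ge> 9"
  shows "card (shortest_images w) \<le> 8 * (len w - 5)"
proof -
  let ?sl = "[(s, m), (s, n)]"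
  define e where "e = eps s s"
  have e: "e = 1 \<or> e = - 1" by (auto simp: e_def eps_def)
  define q where "q = nat \<bar>m - n\<bar>"
  note tw = syllables_twisted[of ?sl s w, OF _ _ _ w, simplified, folded e_def]
  have c2: "int (count_core X2 (twisted k w)) = \<bar>m + k * e\<bar> + \<bar>n + k * e\<bar>" for k
    using tw(2) by simp
  have min: "count_core X2 w \<le> count_core X2 (twisted k w)" for k
    using sh invertible_twisted[of k] count_X1_twisted[of k w] unfolding shortest_def
    by (metis (no_types) add_le_cancel_left len_eq twisted_def)
  have "count_core X2 w = q"
  proof -
    \<comment> \<open>Since e^2 = 1, this twist kills the first exponent and reaches the minimum |m
      - n|.\<close>
    define k where "k = - e * m"
    have "m + k * e = 0" "n + k * e = n - m" using e by (auto simp: k_def)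
    then have "int (count_core X2 (twisted k w)) = \<bar>m - n\<bar>" unfolding c2 by simp
    moreover have "int (count_core X2 w) \<ge> \<bar>m - n\<bar>" using c2[of 0] by (simp add: twisted_0)
    ultimately show ?thesis using min[of k] by (simp add: q_def)
  qed
  moreover have "count_core X1 w = 2" using tw(1)[of 0] by (simp add: twisted_0)
  ultimately have len_q: "len w = q + 2" by (simp add: len_eq)
  have rot: "cyc (build [(s, a), (s, b)]) = cyc (build [(s, b), (s, a)])" for a b
    using cyc_append[of "build [(s, a)]" "build [(s, b)]"] by simp
  have fl: "map flip2 (build [(s, a), (s, b)]) = build [(s, - a), (s, - b)]" for a b
    by (simp add: map_flip2_xpow)
  let ?f = "\<lambda>j. build [(s, int j), (s, int j - int q)]"
  have "shortest_images w \<subseteq> {cyc (map \<sigma> (?f j)) | \<sigma> j. signed_perm \<sigma> \<and> j \<in> {..q div 2}}"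
  proof
    fix v assume "v \<in> shortest_images w"
    then obtain \<sigma> k where v: "v = cyc (map \<sigma> (twisted k w))" "signed_perm \<sigma>"
      "count_core X2 (twisted k w) = count_core X2 w"
      using shortest_images_subset[OF sh lt] by blast
    define a b where "a = m + k * e" and "b = n + k * e"
    have ck: "cyc (twisted k w) = cyc (build [(s, a), (s, b)])" using tw(3) by (simp add: a_def b_def)
    have ab: "\<bar>a\<bar> + \<bar>b\<bar> = int q" "\<bar>a - b\<bar> = int q"
      using c2[of k] v(3) \<open>count_core X2 w = q\<close> by (simp_all add: a_def b_def q_def)
    obtain j where j: "j \<le> q" "cyc (twisted k w) = cyc (?f j)"
    proof (cases "a \<ge> b")
      case True
      then have "a \<ge> 0" "b = a - int q" using ab by auto
      then show ?thesis using that[of "nat a"] ab ck by simp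
    next
      case False
      then have "b \<ge> 0" "a = b - int q" using ab by auto
      then show ?thesis using that[of "nat b"] ab ck rot[of a b] by simp
    qed
    show "v \<in> {cyc (map \<sigma> (?f j)) | \<sigma> j. signed_perm \<sigma> \<and> j \<in> {..q div 2}}"
    proof (cases "j \<le> q div 2")
      case True
      then show ?thesis using v(1,2) cyc_map_cong[OF v(2) j(2)] by auto
    next
      case False
      have "cyc (?f j) = cyc (map flip2 (?f (q - j)))"
        unfolding fl using rot[of "int j" "int j - int q"] j(1) by (simp add: of_nat_diff)
      then have "v = cyc (map (\<sigma> \<circ> flip2) (?f (q - j)))"
        using v(1) cyc_map_cong[OF v(2), of "twisted k w" "map flip2 (?f (q - j))"] j(2) by simp
      moreover have "signed_perm (\<sigma> \<circ> flip2)" using v(2) by (intro signed_perm_comp) simp_all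
      moreover have "q - j \<in> {..q div 2}" using False by simp
      ultimately show ?thesis by blast
    qed
  qed
  from card_le_8_times[OF this] have "card (shortest_images w) \<le> 8 * (q div 2 + 1)" by simp
  \<comment> \<open>Here q >= 7 because the length is at least 9; for q = 6 the inequality would
    fail.\<close>
  moreover have "q div 2 + 1 \<le> q - 3" using len len_q by presburger
  ultimately show ?thesis using len_q by simp
qed

text \<open>Apart from the exceptional words, at most \<open>len w - 5\<close> twists are minimal,
  each with eight signed versions. If twisting has no effect, there is only one; otherwise the
  inequality of \<open>flat_stretch\<close> is evaluated by the number of moving syllables.\<close>

lemma card_shortest_images:
  assumes sh: "shortest w" and lt: "count_core X1 w < count_core X2 w" and len: "len w \<ge> 9"
  shows "card (shortest_images w) \<le> 8 * (len w - 5)"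
proof -
  have small: ?thesis if "\<And>k. cyc (twisted k w) = cyc w"
  proof -
    have "shortest_images w \<subseteq> {cyc (map \<sigma> w) | \<sigma> k. signed_perm \<sigma> \<and> k \<in> {0 :: nat}}"
    proof
      fix v assume "v \<in> shortest_images w"
      then obtain \<sigma> k where "v = cyc (map \<sigma> (twisted k w))" "signed_perm \<sigma>"
        using shortest_images_subset[OF sh lt] by blast
      then have "v = cyc (map \<sigma> w)" using cyc_map_cong[OF _ that] by simp
      then show "v \<in> {cyc (map \<sigma> w) | \<sigma> k. signed_perm \<sigma> \<and> k \<in> {0 :: nat}}"
        using \<open>signed_perm \<sigma>\<close> by blast
    qed
    from card_le_8_times[OF this] show ?thesis using len by simp
  qed
  show ?thesis
  proof (cases "count_core X1 w = 0")
    case True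
    then show ?thesis using no_X1_twisted(1) by (intro small)
  next
    case False
    then obtain sl where sl: "sl \<noteq> []" "valid (fst (hd sl)) sl" "cyc w = cyc (build sl)"
      using syllables_exist by blast
    define D where "D = data (fst (hd sl)) sl"
    note tw = syllables_twisted[OF sl(1) refl sl(2,3), folded D_def]
    have D: "admissible_data D" using admissible_data_data[OF sl(2)] by (simp add: D_def)
    show ?thesis
    proof (cases "moving D = 0")
      case True
      then have "cyc (twisted k w) = cyc w" for k
        unfolding tw(3) sl(3) using twist_not_moving[of _ sl] by (simp add: D_def)
      then show ?thesis by (rule small)
    next
      case mv: False
      define q where "q = int (count_core X2 w)"
      define K where "K = {k. weight D k = q}"
      have min: "q \<le> weight D k" for k
      proof -
        have "len w \<le> len (twisted k w)"
          using sh invertible_twisted[of k] by (simp add: shortest_def twisted_def)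
        then show ?thesis using tw(2)[of k] by (simp add: q_def len_eq count_X1_twisted)
      qed
      have mv: "moving D > 0" using mv moving_bounds[OF D] by simp
      note flat = flat_stretch[OF D min mv, folded K_def]
      have "shortest_images w \<subseteq> {cyc (map \<sigma> (twisted k w)) | \<sigma> k. signed_perm \<sigma> \<and> k \<in> K}"
        using shortest_images_subset[OF sh lt] unfolding K_def q_def tw(2)[symmetric] of_nat_eq_iff by blast
      from card_le_8_times[OF this flat(1)] have card: "card (shortest_images w) \<le> 8 * card K" .
      have lenD: "int (length D) = int (count_core X1 w)" using tw(1)[of 0] by (simp add: D_def twisted_0)
      have lenw: "int (len w) = int (length D) + q" using lenD by (simp add: len_eq q_def)
      from flat(2) show ?thesis
      proof
        assume "card K \<le> 1"
        then show ?thesis using card len by simp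
      next
        assume "\<exists>d\<ge>1. int (card K) \<le> d + 1 \<and> even (moving D) \<and>
          d * moving D + 2 * (int (length D) - moving D) \<le> 2 * q"
        then obtain d where d: "d \<ge> 1" "int (card K) \<le> d + 1" "even (moving D)"
          "d * moving D + 2 * (int (length D) - moving D) \<le> 2 * q" by blast
        have mv_le: "moving D \<le> int (length D)" using moving_bounds[OF D] by simp
        have "moving D \<ge> 2" using d(3) mv by (cases "moving D = 1") auto
        show ?thesis
        proof (cases "moving D = 2")
          case True
          show ?thesis
          proof (cases "length D = 2")
            case 2: True
            then obtain s m n where "sl = [(s, m), (s, n)]"
              using two_syllables[of sl] True by (auto simp: D_def)
            then show ?thesis using card_two_syllables[OF sh lt _ len] sl(3) by simp
          next
            case False
            moreover have "length D \<noteq> 3" using moving_length_3[of sl] True by (auto simp: D_def)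
            ultimately have "length D \<ge> 4" using mv_le True by simp
            \<comment> \<open>With L = \<open>length D\<close> >= 4 and two moving syllables, d + L
              - 2 <= q, so L + q >= d + 2 L - 2 >= d + 6.\<close>
            then have "d + 6 \<le> int (len w)" using d(4) True lenw by simp
            then show ?thesis using card d(2) len by simp
          qed
        next
          case False
          then have "moving D \<ge> 4" using d(3) \<open>moving D \<ge> 2\<close> by (cases "moving D = 3") auto
          then have "d * 4 \<le> d * moving D" using d(1) by (intro mult_left_mono) auto
          \<comment> \<open>For d >= 2 the moving syllables give 4 (d - 2) + 2 L <= 2 q with L =
            \<open>length D\<close> >= 4, so L + q >= 2 d + 4 >= d + 6. For d = 1 the assumed length
            suffices.\<close>
          moreover have "(d - 2) * 4 \<le> (d - 2) * moving D \<or> d = 1"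
            using mult_left_mono[OF \<open>moving D \<ge> 4\<close>, of "d - 2"] d(1) by linarith
          ultimately have "d + 6 \<le> int (len w)"
            using d(1,4) lenw mv_le len \<open>moving D \<ge> 4\<close> by (auto simp: algebra_simps)
          then show ?thesis using card d(2) len by simp
        qed
      qed
    qed
  qed
qed

lemma subst_map_swap: "subst U V (map swap w) = subst V U w"
  by (simp add: map_signed_perm subst_subst)

lemma shortest_swap: "shortest w \<Longrightarrow> shortest (map swap w)"
  using invertible_swap by (auto simp: shortest_def subst_map_swap len_map)

lemma shortest_images_swap: "shortest_images (map swap w) = shortest_images w"
  using invertible_swap by (auto simp: shortest_images_def subst_map_swap len_map)

lemma N_le:
  assumes "admissible u" "cyclic_length u \<ge> 9"
  shows "int (N u) \<le> 8 * int (cyclic_length u) - 40"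
proof -
  obtain w where u: "u = cyc w" using assms(1) cyclic_words_cyc by (auto simp: admissible_def)
  have sh: "shortest w" using assms(1) minimal_in_orbit_iff by (simp add: admissible_def u)
  have len: "len w \<ge> 9" using assms(2) by (simp add: u cyclic_length_cyc)
  have occ: "count_core X1 w > 0 \<Longrightarrow> count_core X2 w > 0 \<Longrightarrow> count_core X1 w < count_core X2 w"
    using assms(1) by (simp add: admissible_def u occurrences_cyc)
  have "card (shortest_images w) \<le> 8 * (len w - 5)"
  proof (cases "count_core X2 w = 0")
    case True
    \<comment> \<open>Only x1 occurs here; exchanging the generators produces the strict
      inequality.\<close>
    then have "count_core X1 (map swap w) < count_core X2 (map swap w)" using len by (simp add: len_eq)
    then show ?thesis
      using card_shortest_images[OF shortest_swap[OF sh]] len len_map[of swap w] shortest_images_swap by simp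
  next
    case False
    then have "count_core X1 w < count_core X2 w" using occ by (cases "count_core X1 w = 0") auto
    then show ?thesis using card_shortest_images[OF sh] len by simp
  qed
  then show ?thesis using len by (simp add: u N_cyc cyclic_length_cyc)
qed

section \<open>Sharpness\<close>

text \<open>Persistence only sees which neighbours have equal sign, and a signed permutation
  respects equality of signs either itself or after composition with \<open>flip2\<close>.\<close>

lemma persistence_map_cases:
  assumes "signed_perm \<pi>"
  shows "persistence (map \<pi> w) = persistence w \<or> persistence (map \<pi> w) = persistence (map flip2 w)"
proof -
  have *: "persistence (map \<rho> v) = persistence v"
    if "signed_perm \<rho>" "snd (\<rho> (X1, True)) = snd (\<rho> (X2, True))" for \<rho> v
  proof (rule persistence_map[OF that(1)])
    fix a b
    show "snd (\<rho> a) = snd (\<rho> b) \<longleftrightarrow> snd a = snd b"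
      using that by (cases a rule: letter_cases; cases b rule: letter_cases)
        (simp_all add: signed_perm_False inv_letter_def)
  qed
  show ?thesis
  proof (cases "snd (\<pi> (X1, True)) = snd (\<pi> (X2, True))")
    case False
    have "flip2 \<circ> flip2 = id"
    proof
      fix a show "(flip2 \<circ> flip2) a = id a" by (cases a rule: letter_cases) simp_all
    qed
    then have "map \<pi> w = map (\<pi> \<circ> flip2) (map flip2 w)" by (simp add: o_assoc[symmetric])
    moreover have "persistence (map (\<pi> \<circ> flip2) (map flip2 w)) = persistence (map flip2 w)"
      using False signed_perm_comp[OF assms signed_perm_flips(2)]
      by (intro *) (auto simp: signed_perm_False[OF assms] inv_letter_def)
    ultimately show ?thesis by metis
  qed (use * assms in blast)
qed

lemma balanced_all_signs:
  assumes "balanced w" "balanced (map flip2 w)" "signed_perm \<pi>"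
  shows "balanced (map \<pi> w)"
proof -
  have f: "count_core g (map flip2 w) = count_core g w" for g
    using count_core_map[of flip2 g w] by (cases g) simp_all
  have "count_core g (map \<pi> w) \<in> {count_core X1 w, count_core X2 w}" for g
  proof -
    have "fst (\<pi> (X1, True)) \<noteq> fst (\<pi> (X2, True))" using assms(3) by (simp add: signed_perm_def)
    then have "g = fst (\<pi> (X1, True)) \<or> g = fst (\<pi> (X2, True))" by (metis gen.exhaust)
    then show ?thesis using count_core_map[OF assms(3)] by auto
  qed
  then have "count_core g (map \<pi> w) \<le> persistence w \<and> count_core g (map \<pi> w) \<le> persistence (map flip2 w)" for g
    using assms(1,2) f unfolding balanced_def by (metis insertE singletonD)
  then show ?thesis using persistence_map_cases[OF assms(3), of w] unfolding balanced_def by metis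
qed

text \<open>A converse of \<open>shortest_balanced\<close> that tests only two of the eight signed
  versions.\<close>

lemma balanced_shortest:
  assumes "balanced w" "balanced (map flip2 w)"
  shows "shortest w"
  using balanced_orbit(1)[OF balanced_all_signs[OF assms]] by (simp add: shortest_def)

text \<open>The twists of the extremal word. Four syllables, the first two of them moving, are the
  equality case of \<open>card_shortest_images\<close>; the weight |k| + |k - d| + 2 is minimal for
  0 <= k <= d.\<close>

definition ex_syllables :: "nat \<Rightarrow> int \<Rightarrow> syllables" where
  "ex_syllables d k = [(True, k), (True, k - int d), (True, 1), (False, 1)]"

definition ex_word :: "nat \<Rightarrow> int \<Rightarrow> word" where
  "ex_word d k = build (ex_syllables d k)"

lemma twist_ex: "twist k True (ex_syllables d 0) = ex_syllables d k"
  by (simp add: ex_syllables_def eps_def)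

lemma core_ex: "core (ex_word d k) = ex_word d k"
  unfolding ex_word_def by (rule core_build) (auto simp: ex_syllables_def)

lemma ex_twisted:
  "count_core X1 (twisted k (ex_word d 0)) = 4"
  "int (count_core X2 (twisted k (ex_word d 0))) = \<bar>k\<bar> + \<bar>k - int d\<bar> + 2"
  "cyc (twisted k (ex_word d 0)) = cyc (ex_word d k)"
  using syllables_twisted(1-3)[of "ex_syllables d 0" True "ex_word d 0" k]
  by (auto simp: ex_word_def twist_ex) (auto simp: ex_syllables_def eps_def)

lemma ex_counts: "count_core X1 (ex_word d 0) = 4" "count_core X2 (ex_word d 0) = d + 2"
  using ex_twisted(1,2)[of 0 d] by (simp_all add: twisted_0)

text \<open>The twists by 1 and -1 give persistence d + 2 and d + 4, to be compared with the counts
  4 and d + 2.\<close>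

lemma shortest_ex: "d \<ge> 3 \<Longrightarrow> shortest (ex_word d 0)"
proof (rule balanced_shortest)
  assume d: "d \<ge> 3"
  have "persistence (ex_word d 0) = d + 2"
    using ex_twisted(2)[of 1 d] count_X2_twisted_1[of "ex_word d 0"] d by simp
  then show "balanced (ex_word d 0)" using d by (simp add: balanced_def ex_counts)
  have f: "count_core g (map flip2 w) = count_core g w" for g w
    using count_core_map[of flip2 g w] by (cases g) simp_all
  have "persistence (map flip2 (ex_word d 0)) = count_core X2 (map flip2 (twisted 1 (map flip2 (ex_word d 0))))"
    using count_X2_twisted_1 f by simp
  also have "\<dots> = d + 4"
    unfolding flip2_twisted using ex_twisted(2)[of "- 1" d] by simp
  finally show "balanced (map flip2 (ex_word d 0))" using d by (simp add: balanced_def f ex_counts)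
qed

definition sign_perm :: "bool \<Rightarrow> bool \<Rightarrow> bool \<Rightarrow> letter \<Rightarrow> letter" where
  "sign_perm b s t = (if b then perm_of (X1, s) (X2, t) else perm_of (X2, s) (X1, t))"

lemma signed_perm_sign_perm: "signed_perm (sign_perm b s t)"
  by (simp add: sign_perm_def signed_perm_perm_of)

lemma count_list_map: "signed_perm \<pi> \<Longrightarrow> count_list (map \<pi> w) (\<pi> a) = count_list w a"
  by (induction w) (auto simp: signed_perm_eq_iff)

lemma count_list_replicate: "count_list (replicate n a) b = (if a = b then n else 0)"
  by (induction n) auto

lemma count_ex:
  assumes "j \<le> d"
  shows "count_list (ex_word d (int j)) (X1, True) = 3" "count_list (ex_word d (int j)) (X1, False) = 1"
    "count_list (ex_word d (int j)) (X2, True) = j + 2" "count_list (ex_word d (int j)) (X2, False) = d - j"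
  using assms by (auto simp: ex_word_def ex_syllables_def xpow_def count_list_append count_list_replicate)

lemma set_adj: "(c, x) \<in> set (adj z w) \<Longrightarrow> x = z \<or> x \<in> set w"
proof (induction w)
  case (Cons a w)
  then show ?case by (cases w) auto
qed simp

text \<open>The only letter x1^-1 is preceded by x2. This determines the image of x2, which letter
  counts need not do: inverting x2 exchanges j + 2 and d - j, which another value of j may
  imitate.\<close>

lemma adj_ex: "(c, (X1, False)) \<in> set (cadj (ex_word d k)) \<longleftrightarrow> c = (X2, True)"
proof -
  let ?A = "build [(True, k), (True, k - int d)]"
  have w: "ex_word d k = ?A @ [(X1, True), (X2, True), (X1, False), (X2, True)]"
    by (simp add: ex_word_def ex_syllables_def)
  have "cadj (ex_word d k) = adj (X1, True) ?A @
      [((X1, True), (X2, True)), ((X2, True), (X1, False)), ((X1, False), (X2, True)), ((X2, True), (X1, True))]"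
    unfolding cadj_def w adj_append by simp
  moreover have "(c, (X1, False)) \<notin> set (adj (X1, True) ?A)"
    using set_adj[of c "(X1, False)" "(X1, True)" ?A] by (auto simp: xpow_def)
  ultimately show ?thesis by auto
qed

text \<open>The parameters are recovered in turn: \<open>b\<close> from the number of letters of x1,
  which is 4 or d + 2; \<open>s\<close> from their split into 3 and 1; \<open>t\<close> from the
  predecessor of the rarer letter; \<open>j\<close> from a count of letters of x2.\<close>

lemma ex_distinct:
  assumes "d \<ge> 3" "j \<le> d" "j' \<le> d"
    and eq: "cyc (map (sign_perm b s t) (ex_word d (int j))) = cyc (map (sign_perm b' s' t') (ex_word d (int j')))"
  shows "b = b' \<and> s = s' \<and> t = t' \<and> j = j'"
proof -
  let ?\<pi> = "sign_perm b s t" and ?\<rho> = "sign_perm b' s' t'"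
  let ?v = "map ?\<pi> (ex_word d (int j))" and ?v' = "map ?\<rho> (ex_word d (int j'))"
  have "core ?v = ?v" "core ?v' = ?v'" by (simp_all add: core_map signed_perm_sign_perm core_ex)
  then obtain n where n: "?v = rotate n ?v'" using core_cong[OF eq] by metis
  have cnt: "count_list ?v a = count_list ?v' a" for a
    unfolding n count_list_eq_length_filter by (rule length_filter_rotate)
  have adj: "set (cadj ?v) = set (cadj ?v')"
    unfolding n using mset_cadj_rotate by (metis set_mset_mset)
  have l: "count_list ?v (?\<pi> a) = count_list (ex_word d (int j)) a"
    "count_list ?v' (?\<rho> a) = count_list (ex_word d (int j')) a" for a
    using count_list_map[OF signed_perm_sign_perm] by blast+
  have count_X1: "count_core X1 (map (sign_perm b s t) (ex_word d (int j))) = (if b then 4 else d + 2)"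
    if "j \<le> d" for b s t j
  proof -
    have "count_core X1 (ex_word d (int j)) = 4" "count_core X2 (ex_word d (int j)) = d + 2"
      unfolding count_core_def core_ex using that by (simp_all add: ex_word_def ex_syllables_def)
    then show ?thesis
      using count_core_map[OF signed_perm_sign_perm, of b s t X1] count_core_map[OF signed_perm_sign_perm, of b s t X2]
      by (cases b) (simp_all add: sign_perm_def)
  qed
  have b: "b = b'"
    using count_core_cong[OF eq, of X1] count_X1[OF assms(2)] count_X1[OF assms(3)] assms(1)
    by (simp split: if_splits)
  let ?g = "if b then X1 else X2" and ?h = "if b then X2 else X1"
  have im: "?\<pi> (X1, True) = (?g, s)" "?\<rho> (X1, True) = (?g, s')" "?\<pi> (X1, False) = (?g, \<not> s)"
    "?\<rho> (X1, False) = (?g, \<not> s')" "?\<pi> (X2, True) = (?h, t)" "?\<rho> (X2, True) = (?h, t')"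
    by (simp_all add: sign_perm_def b)
  have s: "s = s'"
  proof (rule ccontr)
    assume "s \<noteq> s'"
    then have "?\<pi> (X1, True) = ?\<rho> (X1, False)" unfolding im by simp
    then show False
      using cnt[of "?\<pi> (X1, True)"] l(1)[of "(X1, True)"] l(2)[of "(X1, False)"]
      by (simp only: count_ex[OF assms(2)] count_ex[OF assms(3)])
  qed
  have ne: "ex_word d k \<noteq> []" for k by (simp add: ex_word_def ex_syllables_def)
  have pair: "(\<sigma> (X2, True), \<sigma> (X1, False)) \<in> set (cadj (map \<sigma> (ex_word d k)))" for \<sigma> k
    unfolding cadj_map[OF ne] using adj_ex[of "(X2, True)" d k] by (force simp: image_iff)
  have pairD: "c = \<sigma> (X2, True)" if "(c, \<sigma> (X1, False)) \<in> set (cadj (map \<sigma> (ex_word d k)))" "signed_perm \<sigma>" for c \<sigma> k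
    using that(1) unfolding cadj_map[OF ne] by (auto simp: adj_ex signed_perm_eq_iff[OF that(2)])
  have "?\<pi> (X1, False) = ?\<rho> (X1, False)" using im(3,4) s by metis
  then have "(?\<pi> (X2, True), ?\<rho> (X1, False)) \<in> set (cadj ?v')"
    using pair[of ?\<pi>] adj by metis
  then have t: "?\<pi> (X2, True) = ?\<rho> (X2, True)" by (rule pairD) (rule signed_perm_sign_perm)
  have "j + 2 = j' + 2"
    using cnt[of "?\<pi> (X2, True)"] l(1)[of "(X2, True)"] l(2)[of "(X2, True)"] t
    by (simp only: count_ex[OF assms(2)] count_ex[OF assms(3)])
  then show ?thesis using b s t unfolding im by simp
qed

lemma card_shortest_images_ex:
  assumes "d \<ge> 3"
  shows "8 * (d + 1) \<le> card (shortest_images (ex_word d 0))"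
proof -
  let ?w = "ex_word d 0" and ?B = "UNIV :: (bool \<times> bool \<times> bool) set"
  let ?f = "\<lambda>((b, s, t), j). cyc (map (sign_perm b s t) (ex_word d (int j)))"
  have sh: "shortest ?w" using shortest_ex[OF assms] .
  have lt: "count_core X1 ?w < count_core X2 ?w" using assms by (simp add: ex_counts)
  \<comment> \<open>An infinite set has \<open>card\<close> 0, so the lower bound needs finiteness;
    the range of \<open>k\<close> is a crude bound.\<close>
  have fin: "finite (shortest_images ?w)"
  proof (rule finite_subset)
    show "shortest_images ?w \<subseteq> (\<lambda>(\<sigma>, k). cyc (map \<sigma> (twisted k ?w))) ` ({\<sigma>. signed_perm \<sigma>} \<times> {- int d - 2..int d + 2})"
    proof
      fix v assume "v \<in> shortest_images ?w"
      then obtain \<sigma> k where *: "v = cyc (map \<sigma> (twisted k ?w))" "signed_perm \<sigma>"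
        "count_core X2 (twisted k ?w) = count_core X2 ?w"
        using shortest_images_subset[OF sh lt] by blast
      then have "\<bar>k\<bar> \<le> int d" using ex_twisted(2)[of k d] by (simp add: ex_counts)
      then show "v \<in> (\<lambda>(\<sigma>, k). cyc (map \<sigma> (twisted k ?w))) ` ({\<sigma>. signed_perm \<sigma>} \<times> {- int d - 2..int d + 2})"
        using * by (intro image_eqI[of _ _ "(\<sigma>, k)"]) auto
    qed
  qed (simp add: card_signed_perm(1))
  have "?f ` (?B \<times> {..d}) \<subseteq> shortest_images ?w"
  proof
    fix v assume "v \<in> ?f ` (?B \<times> {..d})"
    then obtain b s t j where v: "v = cyc (map (sign_perm b s t) (ex_word d (int j)))" "j \<le> d" by auto
    let ?\<pi> = "sign_perm b s t" and ?t = "subst ((X1, True) # xpow (int j)) [(X2, True)]"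
    have \<pi>: "signed_perm ?\<pi>" by (rule signed_perm_sign_perm)
    let ?p = "subst [?\<pi> (X1, True)] [?\<pi> (X2, True)]"
    have "map ?\<pi> (twisted (int j) ?w) = subst (?p ((X1, True) # xpow (int j))) (?p [(X2, True)]) ?w"
      by (simp only: twisted_def map_signed_perm[OF \<pi>] subst_subst)
    moreover have "invertible (?p ((X1, True) # xpow (int j))) (?p [(X2, True)])"
      by (intro invertible_compose invertible_signed_perm \<pi> invertible_twisted)
    moreover have "len (map ?\<pi> (twisted (int j) ?w)) = len ?w"
      unfolding len_map[OF \<pi>] using ex_twisted(1,2)[of "int j" d] v(2) by (simp add: len_eq ex_counts)
    moreover have "v = cyc (map ?\<pi> (twisted (int j) ?w))"
      using v(1) cyc_map_cong[OF \<pi> ex_twisted(3)] by simp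
    ultimately show "v \<in> shortest_images ?w" unfolding shortest_images_def mem_Collect_eq by metis
  qed
  then have "card (?f ` (?B \<times> {..d})) \<le> card (shortest_images ?w)" using fin by (rule card_mono[rotated])
  moreover have "inj_on ?f (?B \<times> {..d})"
  proof (rule inj_onI)
    fix x y assume "x \<in> ?B \<times> {..d}" "y \<in> ?B \<times> {..d}" "?f x = ?f y"
    moreover obtain b s t j where "x = ((b, s, t), j)" by (metis prod.collapse)
    moreover obtain b' s' t' j' where "y = ((b', s', t'), j')" by (metis prod.collapse)
    ultimately show "x = y" using ex_distinct[OF assms, of j j' b s t b' s' t'] by simp
  qed
  then have "card (?f ` (?B \<times> {..d})) = 8 * (d + 1)"
    by (simp add: card_image card_cartesian_product flip: UNIV_Times_UNIV)
  ultimately show ?thesis by simp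
qed

theorem theorem1p4:
  shows "(\<forall>u. admissible u \<and> cyclic_length u \<ge> 9 \<longrightarrow>
            int (N u) \<le> 8 * int (cyclic_length u) - 40) \<and>
         (\<exists>U :: nat \<Rightarrow> cyclic_word.
            (\<forall>l. admissible (U l) \<and> cyclic_length (U l) \<ge> 9) \<and>
            filterlim (\<lambda>l. cyclic_length (U l)) at_top sequentially \<and>
            (\<forall>l. int (N (U l)) = 8 * int (cyclic_length (U l)) - 40))"
proof (intro conjI exI[of _ "\<lambda>l. cyc (ex_word (l + 3) 0)"] allI impI)
  fix u assume "admissible u \<and> 9 \<le> cyclic_length u"
  then show "int (N u) \<le> 8 * int (cyclic_length u) - 40" using N_le by blast
next
  \<comment> \<open>The shift by 3 starts the family at length 9; with d = l + 3 the count 8 (d + 1)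
    equals 8 (l + 9) - 40.\<close>
  have len: "cyclic_length (cyc (ex_word (l + 3) 0)) = l + 9" for l
    by (simp add: cyclic_length_cyc len_eq ex_counts)
  show "filterlim (\<lambda>l. cyclic_length (cyc (ex_word (l + 3) 0))) at_top sequentially"
    unfolding len by (rule filterlim_at_top_mono[OF filterlim_ident]) simp
  fix l
  show len9: "9 \<le> cyclic_length (cyc (ex_word (l + 3) 0))" by (simp add: len)
  show adm: "admissible (cyc (ex_word (l + 3) 0))"
    using shortest_ex[of "l + 3"]
    by (simp add: admissible_def cyc_cyclic_words minimal_in_orbit_iff occurrences_cyc ex_counts)
  show "int (N (cyc (ex_word (l + 3) 0))) = 8 * int (cyclic_length (cyc (ex_word (l + 3) 0))) - 40"
    using N_le[OF adm len9] card_shortest_images_ex[of "l + 3"] by (simp add: len N_cyc)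
qed

end
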